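(* Let $A\in\mathfrak{P}^{(k,\ell)}$ with $\ell$ even, $n+k-\ell\neq0$ and $n+2k-2\ell\ne0$, and let $A=A_0+DA\wedge e^{(k,\ell)}$ with $DA_0=0$. Then the bracket of $A$ with itself satisfies, with $[A,A]_0:=[A,A]-D[A,A]\wedge e^{(2k,2\ell)}$, $$[A,A]_0=[A_0,A_0]+\frac{2(k-\ell)}{n+k-\ell}\big(DA\wedge A_0-[DA,A_0]\wedge e^{(2k,2\ell)}\big),\qquad D[A,A]=-2[DA,A_0].$$ Moreover, in $[DA,A_0]$ and $DA\wedge A_0$ one may replace $A_0$ by $A$, i.e. $[DA,A_0]=[DA,A]$ and $DA\wedge A_0=DA\wedge A$.
   Context: Let $V=\mathbb{R}^n$ with linear coordinates $x^1,\dots,x^n$ and $\partial_i=\partial/\partial x^i$. $\mathfrak{P}^{(k,\ell)}\cong S^k(V^* )\otimes\Lambda^\ell V$ denotes the space of $\ell$-vector fields on $V$ whose coefficients are homogeneous polynomials of degree $k$ (zero if $k<0$, $\ell<0$ or $\ell>n$). The trace operator $D:\mathfrak{P}^{(k,\ell)}\to\mathfrak{P}^{(k-1,\ell-1)}$ is given, for $U=\frac1{\ell!}U^{j_1\ldots j_\ell}\partial_{j_1}\wedge\cdots\wedge\partial_{j_\ell}$, by $D(U)=\frac{1}{(\ell-1)!}\partial_mU^{j_1\ldots j_{\ell-1}m}\partial_{j_1}\wedge\cdots\wedge\partial_{j_{\ell-1}}$ (and $D=0$ on functions). $[\cdot,\cdot]$ is the Schouten bracket: the bilinear extension of the Lie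 bracket to poly-vector fields with $[X,U]=L_XU$ for vector fields $X$, $[f,g]=0$ for functions, $[U,W]=-(-1)^{(u-1)(w-1)}[W,U]$ and $[U,W\wedge Z]=[U,W]\wedge Z+(-1)^{(u-1)w}W\wedge[U,Z]$ for $U,W$ of degrees $u,w$. It maps $\mathfrak{P}^{(k,\ell)}\times\mathfrak{P}^{(k',\ell')}$ to $\mathfrak{P}^{(k+k'-1,\ell+\ell'-1)}$. Set $e^{(k,\ell)}=\frac{1}{n+k-\ell}e_0$ with $e_0=x^m\partial_m$ (sum over $m$), defined when $n+k-\ell\ne0$; it depends only on $k-\ell$. Every $A\in\mathfrak{P}^{(k,\ell)}$ is uniquely $A=A_0+DA\wedge e^{(k,\ell)}$ with $A_0$ trace free ($DA_0=0$), so $[A,A]_0$ is the trace-free part of $[A,A]$. *)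

theory Defs
  imports "HOL-Analysis.Analysis" "HOL-Library.Function_Algebras"
begin

text \<open>
  A poly-vector field on \<open>V = real ^ 'n\<close> is given by its components:
  \<open>U [j\<^sub>1, \<dots>, j\<^sub>l] x\<close> is the coefficient \<open>U\<^bsup>j\<^sub>1 \<dots> j\<^sub>l\<^esup>(x)\<close> in
  \<open>U = 1/l! U\<^bsup>j\<^sub>1 \<dots> j\<^sub>l\<^esup> \<partial>\<^bsub>j\<^sub>1\<^esub> \<and> \<dots> \<and> \<partial>\<^bsub>j\<^sub>l\<^esub>\<close>, antisymmetric in the indices.
  An \<open>l\<close>-vector field vanishes on all lists of length different from \<open>l\<close>.
  Addition, subtraction and \<open>0\<close> are pointwise (\<^theory>\<open>HOL-Library.Function_Algebras\<close>).
\<close>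

type_synonym 'n mvfield = "'n list \<Rightarrow> real ^ 'n \<Rightarrow> real"

definition mv_scale :: "real \<Rightarrow> 'n mvfield \<Rightarrow> 'n mvfield" (infixr "\<odot>" 75) where
  "c \<odot> U = (\<lambda>js x. c * U js x)"

definition hom_poly :: "int \<Rightarrow> (real ^ 'n::finite \<Rightarrow> real) \<Rightarrow> bool" where
  "hom_poly k f \<longleftrightarrow> (\<exists>c :: ('n \<Rightarrow> nat) \<Rightarrow> real.
     f = (\<lambda>x. \<Sum>\<alpha> | int (\<Sum>i\<in>UNIV. \<alpha> i) = k. c \<alpha> * (\<Prod>i\<in>UNIV. x $ i ^ \<alpha> i)))"

definition alternating :: "'n mvfield \<Rightarrow> bool" where
  "alternating U \<longleftrightarrow> (\<forall>js i j. i < length js \<longrightarrow> j < length js \<longrightarrow> i \<noteq> j \<longrightarrow>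
     U (js[i := js ! j, j := js ! i]) = - U js)"

text \<open>
  Degrees are integers.  The space is \<open>{0}\<close> for \<open>k < 0\<close> (empty sum in \<open>hom_poly\<close>), for
  \<open>l < 0\<close> (no list has negative length) and for \<open>l > n\<close> (an index is repeated).
\<close>

definition polyvec :: "int \<Rightarrow> int \<Rightarrow> 'n::finite mvfield set" where
  "polyvec k l = {U. alternating U \<and> (\<forall>js. int (length js) \<noteq> l \<longrightarrow> U js = 0) \<and>
                     (\<forall>js. hom_poly k (U js))}"

definition partial_deriv :: "'n \<Rightarrow> (real ^ 'n::finite \<Rightarrow> real) \<Rightarrow> real ^ 'n \<Rightarrow> real" where
  "partial_deriv m f x = frechet_derivative f (at x) (axis m 1)"

text \<open>
  The exterior product is written as a sum over shuffles: \<open>S\<close> is the set of positions whose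
  indices go to the first factor.  This equals
  \<open>1/(p! q!) \<Sum>\<^sub>\<sigma> sgn \<sigma> U\<^bsup>j\<^bsub>\<sigma>1\<^esub> \<dots> j\<^bsub>\<sigma>p\<^esub>\<^esup> W\<^bsup>j\<^bsub>\<sigma>(p+1)\<^esub> \<dots> j\<^bsub>\<sigma>(p+q)\<^esub>\<^esup>\<close> for a \<open>p\<close>-vector \<open>U\<close> and a
  \<open>q\<close>-vector \<open>W\<close>.
\<close>

definition shuffle_sign :: "nat set \<Rightarrow> real" where
  "shuffle_sign S = (-1) ^ card {(i, j). i \<in> S \<and> j \<notin> S \<and> j < i}"

definition wedge :: "'n mvfield \<Rightarrow> 'n mvfield \<Rightarrow> 'n mvfield" (infixl "\<and>\<^sub>w" 72) where
  "U \<and>\<^sub>w W = (\<lambda>js x. \<Sum>S\<in>Pow {..<length js}.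
       shuffle_sign S * U (nths js S) x * W (nths js (- S)) x)"

definition trace_op :: "'n::finite mvfield \<Rightarrow> 'n mvfield" where
  "trace_op U = (\<lambda>js x. \<Sum>m\<in>UNIV. partial_deriv m (U (js @ [m])) x)"

definition euler_field :: "'n::finite mvfield" where
  "euler_field = (\<lambda>js x. case js of [m] \<Rightarrow> x $ m | _ \<Rightarrow> 0)"

definition e_field :: "int \<Rightarrow> int \<Rightarrow> 'n::finite mvfield" where
  "e_field k l = (1 / real_of_int (int CARD('n) + k - l)) \<odot> euler_field"

text \<open>
  \<open>(L\<^sub>X U)\<^bsup>j\<^sub>1 \<dots> j\<^sub>l\<^esup> = X\<^sup>m \<partial>\<^sub>m U\<^bsup>j\<^sub>1 \<dots> j\<^sub>l\<^esup> - \<Sum>\<^sub>r U\<^bsup>j\<^sub>1 \<dots> m \<dots> j\<^sub>l\<^esup> \<partial>\<^sub>m X\<^bsup>j\<^sub>r\<^esup>\<close>, with \<open>m\<close> in position \<open>r\<close>.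
\<close>

definition lie_deriv :: "'n::finite mvfield \<Rightarrow> 'n mvfield \<Rightarrow> 'n mvfield" where
  "lie_deriv X U = (\<lambda>js x.
     (\<Sum>m\<in>UNIV. X [m] x * partial_deriv m (U js) x)
     - (\<Sum>r<length js. \<Sum>m\<in>UNIV. U (js[r := m]) x * partial_deriv m (X [js ! r]) x))"

text \<open>
  The Schouten bracket on poly-vector fields with polynomial coefficients is characterised by
  its defining rules.  They determine \<open>br\<close> uniquely on the spaces \<open>polyvec k l\<close>, since each
  element is a linear combination of products of a function and coordinate fields; nothing is
  said about \<open>br\<close> on other arguments.  The exponents of \<open>-1\<close> are integers because degree \<open>0\<close>
  is allowed.
\<close>

definition schouten_bracket :: "('n::finite mvfield \<Rightarrow> 'n mvfield \<Rightarrow> 'n mvfield) \<Rightarrow> bool" where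
  "schouten_bracket br \<longleftrightarrow>
     (\<forall>k u k' w. \<forall>U\<in>polyvec k u. \<forall>W\<in>polyvec k' w.
        br U W \<in> polyvec (k + k' - 1) (u + w - 1)) \<and>
     (\<forall>k u k' w. \<forall>U\<in>polyvec k u. \<forall>U'\<in>polyvec k u. \<forall>W\<in>polyvec k' w. \<forall>a b.
        br (a \<odot> U + b \<odot> U') W = a \<odot> br U W + b \<odot> br U' W) \<and>
     (\<forall>k u k' w. \<forall>U\<in>polyvec k u. \<forall>W\<in>polyvec k' w. \<forall>W'\<in>polyvec k' w. \<forall>a b.
        br U (a \<odot> W + b \<odot> W') = a \<odot> br U W + b \<odot> br U W') \<and>
     (\<forall>k k' u. \<forall>X\<in>polyvec k 1. \<forall>U\<in>polyvec k' u. br X U = lie_deriv X U) \<and>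
     (\<forall>k k'. \<forall>f\<in>polyvec k 0. \<forall>g\<in>polyvec k' 0. br f g = 0) \<and>
     (\<forall>k u k' w. \<forall>U\<in>polyvec k u. \<forall>W\<in>polyvec k' w.
        br U W = (- ((-1) powi ((u - 1) * (w - 1)))) \<odot> br W U) \<and>
     (\<forall>k u k' w k'' z. \<forall>U\<in>polyvec k u. \<forall>W\<in>polyvec k' w. \<forall>Z\<in>polyvec k'' z.
        br U (W \<and>\<^sub>w Z) = br U W \<and>\<^sub>w Z + ((-1) powi ((u - 1) * w)) \<odot> (W \<and>\<^sub>w br U Z))"

end

theory Submission
  imports Defs
begin

text \<open>
  The trace operator \<open>D\<close> is a Batalin-Vilkovisky operator that generates the Schouten bracket:
  it is a differential, and its failure to be a graded derivation of the exterior product is,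
  up to sign, the bracket,
  \<open>D (U \<and> W) = U \<and> D W + (-1)\<^sup>w D U \<and> W + (-1)\<^sup>w [U, W]\<close>.
  For \<open>A\<close> of even degree put \<open>B = D A\<close>, which is odd, so that \<open>B \<and> B = 0\<close> and \<open>[B, B] = 0\<close>.
  Then \<open>D (A \<and> A) = 2 B \<and> A + [A, A]\<close> and \<open>D (B \<and> A) = [B, A]\<close>, and applying \<open>D\<close> to the first
  equation gives \<open>D [A, A] = -2 [B, A]\<close> (\<open>trace_br_self\<close>).

  Everything else is bilinear algebra with \<open>A = A\<^sub>0 + B \<and> e\<close>, where \<open>e\<close> is a multiple of the Euler
  field \<open>e\<^sub>0\<close>.  Bracketing with \<open>e\<^sub>0\<close> multiplies a \<open>u\<close>-vector with coefficients of degree \<open>k\<close> by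
  \<open>\<plusminus>(k - u)\<close> (\<open>lie_deriv_euler\<close>).  Hence every term that contains \<open>B\<close> twice vanishes, because it
  contains \<open>B \<and> B\<close> or \<open>[B, B]\<close>.  This removes \<open>B \<and> e\<close> from \<open>B \<and> A\<close> and \<open>[B, A]\<close>, and removes
  \<open>[B \<and> e, B \<and> e]\<close>.  Only the mixed term \<open>[A\<^sub>0, B \<and> e\<^sub>0] = (k - l) B \<and> A\<^sub>0 - [B, A\<^sub>0] \<and> e\<^sub>0\<close> survives.
  Subtracting \<open>D [A, A] \<and> e\<close> for the degrees of \<open>[A, A]\<close> combines the coefficients \<open>2 / (N + d)\<close> and
  \<open>- 2 / N\<close> of \<open>[B, A\<^sub>0] \<and> e\<^sub>0\<close>, where \<open>N = n + k - l\<close> and \<open>d = k - l\<close>.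

  The bracket is only known through its characterising rules, so the generating identity needs
  an explicit formula for it.  The identity is immediate from the coordinate formula
  \<open>coord_bracket\<close> (\<open>trace_wedge\<close>), and the formula is the Schouten bracket by uniqueness
  (\<open>br_eq_coord_bracket\<close>): each \<open>w\<close>-vector field \<open>W\<close> satisfies
  \<open>w W = \<Sum>\<^sub>m (\<iota>\<^sub>m W) \<and> \<partial>\<^sub>m\<close>, so the Leibniz rule reduces a second argument of degree \<open>w\<close> to degree
  \<open>w - 1\<close> and to the coordinate fields.

  All facts on the exterior product rest on one recursion, \<open>contract_wedge\<close>: contraction of the
  last index is a graded derivation.  Associativity, graded commutativity and
  alternation then follow by induction on the index list.
\<close>

section \<open>Exterior products by recursion on the last index\<close>

text \<open>
  The last index is the one that the trace contracts, and removing it makes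
  \<open>rev_induct\<close> on index lists the natural induction.
\<close>

definition contract :: "'n \<Rightarrow> 'n mvfield \<Rightarrow> 'n mvfield" where
  "contract m U = (\<lambda>js. U (js @ [m]))"

text \<open>
  The grading involution.  It carries the sign \<open>(-1)\<^sup>w\<close> of the graded Leibniz rules for fields
  that need not be homogeneous, so those rules hold as plain identities.
\<close>

definition twist :: "'n mvfield \<Rightarrow> 'n mvfield" where
  "twist U = (\<lambda>js x. (-1) ^ length js * U js x)"

definition of_degree :: "int \<Rightarrow> 'n mvfield \<Rightarrow> bool" where
  "of_degree l U \<longleftrightarrow> (\<forall>js. int (length js) \<noteq> l \<longrightarrow> U js = 0)"

lemma mv_scale_apply: "(c \<odot> U) js x = c * U js x"
  by (simp add: mv_scale_def)

lemma sum_mvfield_apply: "(\<Sum>i\<in>I. F i) js x = (\<Sum>i\<in>I. F i js x)"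
  for F :: "'i \<Rightarrow> 'n mvfield"
  by (induction I rule: infinite_finite_induct) simp_all

lemma mv_scale_simps:
  "1 \<odot> U = U" "0 \<odot> U = 0" "c \<odot> 0 = 0" "a \<odot> b \<odot> U = (a * b) \<odot> U"
  "(- 1) \<odot> U = - U"
  by (simp_all add: fun_eq_iff mv_scale_apply)

lemma mv_scale_add: "c \<odot> (U + W) = c \<odot> U + c \<odot> W"
  by (simp add: fun_eq_iff mv_scale_apply algebra_simps)

lemma mv_scale_sum: "c \<odot> (\<Sum>i\<in>I. F i) = (\<Sum>i\<in>I. c \<odot> F i)"
  by (simp add: fun_eq_iff mv_scale_apply sum_mvfield_apply sum_distrib_left)

lemma minus_one_powi_eq_if: "(-1 :: real) powi n = (if even n then 1 else -1)"
  by (cases n rule: int_cases4) (auto simp: power_int_minus_left)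

lemma nths_cong:
  assumes "\<And>i. i < length xs \<Longrightarrow> i \<in> A \<longleftrightarrow> i \<in> B"
  shows "nths xs A = nths xs B"
  unfolding nths_def using assms
  by (intro arg_cong[of _ _ "map fst"] filter_cong refl) (auto simp: set_zip)

text \<open>
  A new largest position in the first factor jumps over every position of the second.
\<close>

lemma shuffle_sign_insert:
  assumes "S \<subseteq> {..<n}"
  shows "shuffle_sign (insert n S) = shuffle_sign S * (-1) ^ card ({..<n} - S)"
proof -
  let ?I = "{(i, j). i \<in> S \<and> j \<notin> S \<and> j < i}"
  have "?I \<subseteq> {..<n} \<times> {..<n}" using assms by fastforce
  then have fin: "finite ?I" by (rule finite_subset) simp
  have "{(i, j). i \<in> insert n S \<and> j \<notin> insert n S \<and> j < i} = ?I \<union> Pair n ` ({..<n} - S)"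
    using assms by auto
  moreover have "card (?I \<union> Pair n ` ({..<n} - S)) = card ?I + card (Pair n ` ({..<n} - S))"
    using fin assms by (intro card_Un_disjoint) auto
  moreover have "card (Pair n ` ({..<n} - S)) = card ({..<n} - S)"
    by (rule card_image) (simp add: inj_on_def)
  ultimately show ?thesis by (simp add: shuffle_sign_def power_add)
qed

lemma wedge_Nil: "(U \<and>\<^sub>w W) [] x = U [] x * W [] x"
  by (simp add: wedge_def shuffle_sign_def)

text \<open>
  The last position belongs to the second factor or to the first; in the second case it passes
  all indices of \<open>W\<close>, which is the sign in \<open>twist W\<close>.  Together with \<open>wedge_Nil\<close> this
  determines the product recursively.
\<close>

lemma contract_wedge:
  "contract m (U \<and>\<^sub>w W) = U \<and>\<^sub>w contract m W + contract m U \<and>\<^sub>w twist W"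
proof (intro ext)
  fix js :: "'a list" and x
  let ?n = "length js"
  let ?t = "\<lambda>S. shuffle_sign S * U (nths (js @ [m]) S) x * W (nths (js @ [m]) (- S)) x"
  have inj: "inj_on (insert ?n) (Pow {..<?n})"
    by (rule inj_onI) (metis PowD insert_ident lessThan_iff less_irrefl subsetD)
  have disj: "Pow {..<?n} \<inter> insert ?n ` Pow {..<?n} = {}" by auto
  have "contract m (U \<and>\<^sub>w W) js x = (\<Sum>S\<in>Pow {..<?n} \<union> insert ?n ` Pow {..<?n}. ?t S)"
    by (simp add: contract_def wedge_def lessThan_Suc Pow_insert)
  also have "\<dots> = (\<Sum>S\<in>Pow {..<?n}. ?t S) + (\<Sum>S\<in>Pow {..<?n}. ?t (insert ?n S))"
    by (subst sum.union_disjoint) (simp_all add: disj sum.reindex[OF inj])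
  also have "(\<Sum>S\<in>Pow {..<?n}. ?t S) = (U \<and>\<^sub>w contract m W) js x"
    unfolding wedge_def contract_def
  proof (rule sum.cong[OF refl])
    fix S assume "S \<in> Pow {..<?n}"
    then have "?n \<notin> S" by auto
    then show "?t S = shuffle_sign S * U (nths js S) x * W (nths js (- S) @ [m]) x"
      by (simp add: nths_append)
  qed
  also have "(\<Sum>S\<in>Pow {..<?n}. ?t (insert ?n S)) = (contract m U \<and>\<^sub>w twist W) js x"
    unfolding wedge_def contract_def twist_def
  proof (rule sum.cong[OF refl])
    fix S assume S: "S \<in> Pow {..<?n}"
    have "nths js (insert ?n S) = nths js S" "nths js (- insert ?n S) = nths js (- S)"
      by (auto intro: nths_cong)
    moreover have "{i. i < ?n \<and> i \<in> - S} = {..<?n} - S" by auto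
    ultimately show "?t (insert ?n S) = shuffle_sign S * U (nths js S @ [m]) x *
       ((-1) ^ length (nths js (- S)) * W (nths js (- S)) x)"
      using S by (simp add: nths_append shuffle_sign_insert length_nths)
  qed
  finally show "contract m (U \<and>\<^sub>w W) js x
      = (U \<and>\<^sub>w contract m W + contract m U \<and>\<^sub>w twist W) js x" by simp
qed

lemma wedge_snoc:
  "(U \<and>\<^sub>w W) (js @ [m]) x = (U \<and>\<^sub>w contract m W) js x + (contract m U \<and>\<^sub>w twist W) js x"
  using contract_wedge[of m U W] by (simp add: contract_def fun_eq_iff)

lemma wedge_add_left: "(U + U') \<and>\<^sub>w W = U \<and>\<^sub>w W + U' \<and>\<^sub>w W"
  and wedge_add_right: "U \<and>\<^sub>w (W + W') = U \<and>\<^sub>w W + U \<and>\<^sub>w W'"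
  and wedge_scale_left: "(c \<odot> U) \<and>\<^sub>w W = c \<odot> (U \<and>\<^sub>w W)"
  and wedge_scale_right: "U \<and>\<^sub>w (c \<odot> W) = c \<odot> (U \<and>\<^sub>w W)"
  by (simp_all add: wedge_def fun_eq_iff mv_scale_apply algebra_simps sum.distrib sum_distrib_left)

lemma wedge_zero_left: "0 \<and>\<^sub>w W = 0" and wedge_zero_right: "U \<and>\<^sub>w 0 = 0"
  by (simp_all add: wedge_def fun_eq_iff)

lemma wedge_minus_left: "(- U) \<and>\<^sub>w W = - (U \<and>\<^sub>w W)"
  and wedge_minus_right: "U \<and>\<^sub>w (- W) = - (U \<and>\<^sub>w W)"
  by (simp_all add: wedge_def fun_eq_iff sum_negf)

lemma wedge_sum_left: "(\<Sum>i\<in>I. F i) \<and>\<^sub>w W = (\<Sum>i\<in>I. F i \<and>\<^sub>w W)"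
  and wedge_sum_right: "W \<and>\<^sub>w (\<Sum>i\<in>I. F i) = (\<Sum>i\<in>I. W \<and>\<^sub>w F i)"
  by (induction I rule: infinite_finite_induct)
     (simp_all add: wedge_zero_left wedge_zero_right wedge_add_left wedge_add_right)

lemma twist_twist: "twist (twist U) = U"
  by (simp add: twist_def fun_eq_iff flip: mult.assoc power_mult_distrib)

lemma contract_twist: "contract m (twist U) = - twist (contract m U)"
  by (simp add: twist_def contract_def fun_eq_iff)

lemma contract_add: "contract m (U + W) = contract m U + contract m W"
  by (simp add: contract_def fun_eq_iff)

lemma twist_add: "twist (U + W) = twist U + twist W"
  by (simp add: twist_def fun_eq_iff algebra_simps)

lemma contract_scale: "contract m (c \<odot> U) = c \<odot> contract m U"
  by (simp add: contract_def fun_eq_iff mv_scale_apply)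

lemma twist_of_degree: "of_degree l U \<Longrightarrow> twist U = ((-1) powi l) \<odot> U"
  unfolding twist_def of_degree_def minus_one_powi_eq_if fun_eq_iff mv_scale_apply
  by (metis even_of_nat minus_one_power_iff mult_zero_right zero_fun_apply)

lemma of_degree_contract: "of_degree l U \<Longrightarrow> of_degree (l - 1) (contract m U)"
  by (simp add: of_degree_def contract_def)

lemma twist_wedge_apply: "twist (U \<and>\<^sub>w W) js x = (twist U \<and>\<^sub>w twist W) js x"
proof (induction js arbitrary: U W rule: rev_induct)
  case Nil
  show ?case by (simp add: twist_def wedge_Nil)
next
  case (snoc m js)
  have "twist (U \<and>\<^sub>w W) (js @ [m]) x = - twist (contract m (U \<and>\<^sub>w W)) js x"
    by (simp add: twist_def contract_def)
  also have "\<dots> = - (twist U \<and>\<^sub>w twist (contract m W)) js x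
      - (twist (contract m U) \<and>\<^sub>w twist (twist W)) js x"
    using snoc by (simp add: contract_wedge twist_add)
  finally show ?case
    by (simp add: wedge_snoc contract_twist wedge_minus_left wedge_minus_right)
qed

lemma twist_wedge: "twist (U \<and>\<^sub>w W) = twist U \<and>\<^sub>w twist W"
  by (intro ext twist_wedge_apply)

text \<open>
  Both sides obey the same recursion in the last index, and \<open>twist\<close> is multiplicative.
\<close>

lemma wedge_assoc_apply: "((U \<and>\<^sub>w W) \<and>\<^sub>w Z) js x = (U \<and>\<^sub>w (W \<and>\<^sub>w Z)) js x"
proof (induction js arbitrary: U W Z rule: rev_induct)
  case Nil
  show ?case by (simp add: wedge_Nil)
next
  case (snoc m js)
  show ?case
    by (simp add: wedge_snoc contract_wedge wedge_add_left wedge_add_right twist_wedge snoc)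
qed

lemma wedge_assoc: "(U \<and>\<^sub>w W) \<and>\<^sub>w Z = U \<and>\<^sub>w (W \<and>\<^sub>w Z)"
  by (intro ext wedge_assoc_apply)

text \<open>
  The recursion exchanges its two summands when the factors are exchanged; each contraction
  changes \<open>u w\<close> by \<open>w\<close> or \<open>u\<close>, which is the sign from \<open>twist\<close>.
\<close>

lemma wedge_commute_apply:
  "of_degree u U \<Longrightarrow> of_degree w W \<Longrightarrow>
    (W \<and>\<^sub>w U) js x = (-1) powi (u * w) * (U \<and>\<^sub>w W) js x"
proof (induction js arbitrary: U W u w rule: rev_induct)
  case Nil
  then show ?case
    by (cases "u = 0 \<and> w = 0") (auto simp: wedge_Nil of_degree_def)
next
  case (snoc m js)
  have "(W \<and>\<^sub>w U) (js @ [m]) x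
      = (-1) powi ((u - 1) * w) * (contract m U \<and>\<^sub>w W) js x
        + (-1) powi u * ((-1) powi (u * (w - 1)) * (U \<and>\<^sub>w contract m W) js x)"
    using snoc.IH[OF of_degree_contract[OF snoc.prems(1)] snoc.prems(2)]
      snoc.IH[OF snoc.prems(1) of_degree_contract[OF snoc.prems(2)]]
    by (simp add: wedge_snoc twist_of_degree[OF snoc.prems(1)] wedge_scale_right mv_scale_apply)
  then show ?case
    by (simp add: wedge_snoc twist_of_degree[OF snoc.prems(2)] wedge_scale_right mv_scale_apply
        minus_one_powi_eq_if)
qed

lemma wedge_commute:
  "of_degree u U \<Longrightarrow> of_degree w W \<Longrightarrow> W \<and>\<^sub>w U = ((-1) powi (u * w)) \<odot> (U \<and>\<^sub>w W)"
  by (intro ext) (simp only: mv_scale_apply wedge_commute_apply[of u U w W])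

lemma wedge_self_odd:
  assumes "of_degree u U" "odd u"
  shows "U \<and>\<^sub>w U = 0"
proof (intro ext)
  fix js x
  have "(U \<and>\<^sub>w U) js x = - (U \<and>\<^sub>w U) js x"
    using wedge_commute_apply[OF assms(1) assms(1), of js x] assms(2)
    by (simp only: minus_one_powi_eq_if even_mult_iff if_False mult_minus1 disj_absorb)
  then show "(U \<and>\<^sub>w U) js x = 0 js x" by simp
qed

lemma of_degree_wedge:
  assumes "of_degree u U" "of_degree w W"
  shows "of_degree (u + w) (U \<and>\<^sub>w W)"
proof -
  have "(U \<and>\<^sub>w W) js x = 0" if "int (length js) \<noteq> u + w" for js x
    using assms that
  proof (induction js arbitrary: U W u w rule: rev_induct)
    case Nil
    then show ?case by (cases "u = 0") (auto simp: wedge_Nil of_degree_def)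
  next
    case (snoc m js)
    have "of_degree w (twist W)" using snoc.prems(2) by (auto simp: of_degree_def twist_def fun_eq_iff)
    then show ?case
      using snoc.IH[OF of_degree_contract[OF snoc.prems(1)], of w "twist W" m]
        snoc.IH[OF snoc.prems(1) of_degree_contract[OF snoc.prems(2)], of m] snoc.prems
      by (simp add: wedge_snoc)
  qed
  then show ?thesis by (simp add: of_degree_def fun_eq_iff)
qed

section \<open>Alternation and coordinate fields\<close>

text \<open>
  Adjacent transpositions generate all transpositions; unlike a swap of two arbitrary positions,
  an adjacent swap is stable under removing the last index.
\<close>

lemma alternating_iff_adjacent:
  "alternating U \<longleftrightarrow> (\<forall>J a b K. U (J @ [a, b] @ K) = - U (J @ [b, a] @ K))" (is "_ \<longleftrightarrow> ?R")
proof
  assume U: "alternating U"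
  show ?R
  proof (intro allI)
    fix J K :: "'a list" and a b :: 'a
    let ?l = "J @ [b, a] @ K"
    have "U (?l[length J := ?l ! Suc (length J), Suc (length J) := ?l ! length J]) = - U ?l"
      by (rule U[unfolded alternating_def, rule_format]) simp_all
    then show "U (J @ [a, b] @ K) = - U (J @ [b, a] @ K)"
      by (simp add: nth_append list_update_append)
  qed
next
  assume R: ?R
  \<comment> \<open>Move \<open>a\<close> past the first entry of the gap, use the induction hypothesis, move \<open>b\<close> back:
    three sign changes.\<close>
  have swap: "U (J @ a # K @ b # L) = - U (J @ b # K @ a # L)" for J K L a b
  proof (induction K arbitrary: J)
    case Nil
    show ?case using R[rule_format, of J a b L] by simp
  next
    case (Cons c K)
    show ?case
      using R[rule_format, of J a c "K @ b # L"] R[rule_format, of J b c "K @ a # L"]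
        Cons[of "J @ [c]"] by simp
  qed
  have lt: "U (js[i := js ! j, j := js ! i]) = - U js" if "i < j" "j < length js" for i j js
  proof -
    define J K L where "J = take i js" and "K = take (j - Suc i) (drop (Suc i) js)"
      and "L = drop (Suc j) js"
    have "drop (Suc i) js = K @ drop j js"
      using that by (simp add: K_def) (metis Suc_leI append_take_drop_id drop_drop le_add_diff_inverse2)
    then have js: "js = J @ js ! i # K @ js ! j # L"
      using that unfolding J_def L_def by (metis Cons_nth_drop_Suc dual_order.strict_trans id_take_nth_drop)
    have l: "length J = i" "length K = j - Suc i" using that by (auto simp: J_def K_def)
    have "js[i := js ! j, j := js ! i] = J @ js ! j # K @ js ! i # L"
      using that l by (subst js) (auto simp: list_update_append nth_append split: nat.split)
    then show ?thesis using swap js by metis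
  qed
  show "alternating U"
    unfolding alternating_def
  proof (intro allI impI)
    fix js :: "'a list" and i j assume "i < length js" "j < length js" "i \<noteq> j"
    then show "U (js[i := js ! j, j := js ! i]) = - U js"
      using lt[of i j js] lt[of j i js] list_update_swap[of i j js] by (metis linorder_neqE_nat)
  qed
qed

lemma alternating_adjacent: "alternating U \<Longrightarrow> U (J @ [a, b] @ K) = - U (J @ [b, a] @ K)"
  by (rule alternating_iff_adjacent[THEN iffD1, rule_format])

lemma contract_contract:
  assumes "alternating U" shows "contract a (contract b U) = - contract b (contract a U)"
proof
  fix js show "contract a (contract b U) js = (- contract b (contract a U)) js"
    using alternating_adjacent[OF assms, of js a b "[]"] by (simp add: contract_def)
qed

lemma alternating_contract:
  assumes "alternating U" shows "alternating (contract m U)"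
  unfolding alternating_iff_adjacent
proof (intro allI)
  fix J a b K show "contract m U (J @ [a, b] @ K) = - contract m U (J @ [b, a] @ K)"
    using alternating_adjacent[OF assms, of J a b "K @ [m]"] by (simp add: contract_def)
qed

lemma alternating_twist:
  assumes "alternating U" shows "alternating (twist U)"
  unfolding alternating_iff_adjacent
proof (intro allI)
  fix J a b K show "twist U (J @ [a, b] @ K) = - twist U (J @ [b, a] @ K)"
    using alternating_adjacent[OF assms, of J a b K] by (simp add: twist_def fun_eq_iff)
qed

text \<open>
  An adjacent swap at the end exchanges two anticommuting contractions; a swap further left is
  inherited from the contracted factors.
\<close>

lemma alternating_wedge:
  assumes "alternating U" "alternating W"
  shows "alternating (U \<and>\<^sub>w W)"
proof -
  have "(U \<and>\<^sub>w W) (J @ [a, b] @ K) x = - (U \<and>\<^sub>w W) (J @ [b, a] @ K) x" for J a b K x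
    using assms
  proof (induction K arbitrary: U W rule: rev_induct)
    case Nil
    have two: "(U \<and>\<^sub>w W) (J @ [a, b]) x = contract a (contract b (U \<and>\<^sub>w W)) J x" for a b
      by (simp add: contract_def)
    show ?case
      using contract_contract[OF Nil(1), of a b] contract_contract[OF Nil(2), of a b]
      by (simp add: two contract_wedge contract_add contract_twist twist_twist
          wedge_minus_left wedge_minus_right)
  next
    case (snoc c K)
    note snoc.IH[OF snoc.prems(1) alternating_contract[OF snoc.prems(2)], of c]
      snoc.IH[OF alternating_contract[OF snoc.prems(1)] alternating_twist[OF snoc.prems(2)], of c]
    then show ?case
      using wedge_snoc[of U W "J @ [a, b] @ K" c x] wedge_snoc[of U W "J @ [b, a] @ K" c x]
      by simp
  qed
  then have "(U \<and>\<^sub>w W) (J @ [a, b] @ K) = - (U \<and>\<^sub>w W) (J @ [b, a] @ K)" for J a b K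
    by (intro ext) (metis uminus_apply)
  then show ?thesis unfolding alternating_iff_adjacent by blast
qed

definition coord_field :: "'n \<Rightarrow> 'n mvfield" where
  "coord_field m = (\<lambda>js x. if js = [m] then 1 else 0)"

definition unit_field :: "'n mvfield" where
  "unit_field = (\<lambda>js x. if js = [] then 1 else 0)"

lemma contract_coord: "contract j (coord_field m) = (if j = m then unit_field else 0)"
  by (auto simp: contract_def coord_field_def unit_field_def fun_eq_iff)

lemma twist_coord: "twist (coord_field m) = - coord_field m"
  by (auto simp: twist_def coord_field_def fun_eq_iff)

lemma wedge_unit: "U \<and>\<^sub>w unit_field = U"
proof (intro ext)
  have u: "contract m unit_field = 0" "twist unit_field = unit_field" for m :: 'a
    by (auto simp: contract_def twist_def unit_field_def fun_eq_iff)
  fix js x show "(U \<and>\<^sub>w unit_field) js x = U js x"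
  proof (induction js arbitrary: U rule: rev_induct)
    case Nil
    show ?case by (simp add: wedge_Nil unit_field_def)
  next
    case (snoc m js)
    have "contract m U js x = U (js @ [m]) x" by (simp add: contract_def)
    then show ?case using snoc[of "contract m U"] by (simp add: wedge_snoc u wedge_zero_right)
  qed
qed

text \<open>
  Contracting the sum with \<open>j\<close> produces \<open>\<iota>\<^sub>j W\<close> from \<open>m = j\<close>, and the same sum for \<open>\<iota>\<^sub>j W\<close>, because
  the sign of \<open>twist\<close> on \<open>\<partial>\<^sub>m\<close> cancels the sign from exchanging the two contractions.  Each index
  therefore contributes \<open>1\<close>.
\<close>

lemma sum_contract_wedge_coord_apply:
  fixes W :: "'n::finite mvfield"
  assumes "alternating W"
  shows "(\<Sum>m\<in>UNIV. (contract m W \<and>\<^sub>w coord_field m) js x) = real (length js) * W js x"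
  using assms
proof (induction js arbitrary: W rule: rev_induct)
  case Nil
  show ?case by (simp add: wedge_Nil coord_field_def)
next
  case (snoc j js)
  have "(\<Sum>m\<in>UNIV. (contract m W \<and>\<^sub>w coord_field m) (js @ [j]) x)
      = (\<Sum>m\<in>UNIV. (if m = j then contract j W js x else 0)
           + (contract m (contract j W) \<and>\<^sub>w coord_field m) js x)"
  proof (rule sum.cong[OF refl])
    fix m
    have "(contract m W \<and>\<^sub>w contract j (coord_field m)) js x = (if m = j then contract j W js x else 0)"
      by (simp add: contract_coord wedge_unit wedge_zero_right)
    moreover have "(contract j (contract m W) \<and>\<^sub>w twist (coord_field m)) js x
        = (contract m (contract j W) \<and>\<^sub>w coord_field m) js x"
      by (subst contract_contract[OF snoc.prems])
        (simp add: twist_coord wedge_minus_left wedge_minus_right)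
    ultimately show "(contract m W \<and>\<^sub>w coord_field m) (js @ [j]) x
        = (if m = j then contract j W js x else 0)
          + (contract m (contract j W) \<and>\<^sub>w coord_field m) js x"
      by (simp only: wedge_snoc)
  qed
  also have "\<dots> = contract j W js x + real (length js) * contract j W js x"
    using snoc.IH[OF alternating_contract[OF snoc.prems]] by (simp add: sum.distrib)
  finally show ?case by (simp add: contract_def algebra_simps)
qed

section \<open>Homogeneous polynomials and their partial derivatives\<close>

definition monomial :: "('n \<Rightarrow> nat) \<Rightarrow> real ^ 'n::finite \<Rightarrow> real" where
  "monomial \<alpha> x = (\<Prod>i\<in>UNIV. x $ i ^ \<alpha> i)"

lemma finite_exponents: "finite {\<alpha> :: 'n::finite \<Rightarrow> nat. int (\<Sum>i\<in>UNIV. \<alpha> i) = k}"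
proof (rule finite_subset)
  show "{\<alpha> :: 'n \<Rightarrow> nat. int (\<Sum>i\<in>UNIV. \<alpha> i) = k} \<subseteq> UNIV \<rightarrow>\<^sub>E {..nat k}"
  proof
    fix \<alpha> :: "'n \<Rightarrow> nat" assume "\<alpha> \<in> {\<alpha>. int (\<Sum>i\<in>UNIV. \<alpha> i) = k}"
    moreover have "\<alpha> i \<le> sum \<alpha> UNIV" for i by (rule member_le_sum) simp_all
    ultimately show "\<alpha> \<in> UNIV \<rightarrow>\<^sub>E {..nat k}" by (auto simp: PiE_iff simp del: of_nat_sum)
  qed
  show "finite (UNIV \<rightarrow>\<^sub>E {..nat k} :: ('n \<Rightarrow> nat) set)"
    by (rule finite_PiE) simp_all
qed

lemma hom_poly_alt:
  "hom_poly k f \<longleftrightarrow>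
    (\<exists>c. f = (\<lambda>x. \<Sum>\<alpha> | int (\<Sum>i\<in>UNIV. \<alpha> i) = k. c \<alpha> * monomial \<alpha> x))"
  by (simp add: hom_poly_def monomial_def)

lemma hom_poly_zero: "hom_poly k (\<lambda>x. 0)"
  unfolding hom_poly_alt by (rule exI[of _ "\<lambda>_. 0"]) simp

lemma hom_poly_add: "hom_poly k f \<Longrightarrow> hom_poly k g \<Longrightarrow> hom_poly k (\<lambda>x. f x + g x)"
  unfolding hom_poly_alt
  by (elim exE, rule_tac x = "\<lambda>\<alpha>. c \<alpha> + ca \<alpha>" in exI) (simp add: algebra_simps sum.distrib)

lemma hom_poly_cmult: "hom_poly k f \<Longrightarrow> hom_poly k (\<lambda>x. a * f x)"
  unfolding hom_poly_alt
  by (elim exE, rule_tac x = "\<lambda>\<alpha>. a * c \<alpha>" in exI) (simp add: algebra_simps sum_distrib_left)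

lemma hom_poly_sum: "(\<And>i. i \<in> I \<Longrightarrow> hom_poly k (f i)) \<Longrightarrow> hom_poly k (\<lambda>x. \<Sum>i\<in>I. f i x)"
  by (induction I rule: infinite_finite_induct) (simp_all add: hom_poly_zero hom_poly_add)

lemma hom_poly_monomial:
  assumes "int (\<Sum>i\<in>UNIV. \<alpha> i) = k"
  shows "hom_poly k (monomial \<alpha>)"
  unfolding hom_poly_alt
proof (intro exI ext)
  fix x
  have "(\<Sum>\<beta> | int (\<Sum>i\<in>UNIV. \<beta> i) = k. (if \<beta> = \<alpha> then 1 else 0) * monomial \<beta> x)
      = (\<Sum>\<beta> | int (\<Sum>i\<in>UNIV. \<beta> i) = k. if \<beta> = \<alpha> then monomial \<alpha> x else 0)"
    by (intro sum.cong) auto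
  also have "\<dots> = monomial \<alpha> x"
    using assms by (subst sum.delta) (simp_all add: finite_exponents del: of_nat_sum)
  finally show "monomial \<alpha> x
      = (\<Sum>\<beta> | int (\<Sum>i\<in>UNIV. \<beta> i) = k. (if \<beta> = \<alpha> then 1 else 0) * monomial \<beta> x)" by simp
qed

text \<open>
  Every identity that is linear in \<open>f\<close> reduces to monomials.
\<close>

lemma hom_poly_induct [consumes 1, case_names zero add monomial]:
  assumes "hom_poly k f"
    and "P (\<lambda>x. 0)"
    and "\<And>f g. hom_poly k f \<Longrightarrow> hom_poly k g \<Longrightarrow> P f \<Longrightarrow> P g \<Longrightarrow> P (\<lambda>x. f x + g x)"
    and "\<And>c \<alpha>. int (\<Sum>i\<in>UNIV. \<alpha> i) = k \<Longrightarrow> P (\<lambda>x. c * monomial \<alpha> x)"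
  shows "P f"
proof -
  obtain c where f: "f = (\<lambda>x. \<Sum>\<alpha> | int (\<Sum>i\<in>UNIV. \<alpha> i) = k. c \<alpha> * monomial \<alpha> x)"
    using assms(1) unfolding hom_poly_alt by blast
  have "hom_poly k (\<lambda>x. \<Sum>\<alpha>\<in>I. c \<alpha> * monomial \<alpha> x) \<and> P (\<lambda>x. \<Sum>\<alpha>\<in>I. c \<alpha> * monomial \<alpha> x)"
    if "I \<subseteq> {\<alpha>. int (\<Sum>i\<in>UNIV. \<alpha> i) = k}" for I
    using that
  proof (induction I rule: infinite_finite_induct)
    case (insert \<alpha> I)
    then show ?case
      using assms(3)[of "\<lambda>x. c \<alpha> * monomial \<alpha> x" "\<lambda>x. \<Sum>\<alpha>\<in>I. c \<alpha> * monomial \<alpha> x"]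
        assms(4)[of \<alpha> "c \<alpha>"]
        hom_poly_add[of k "\<lambda>x. c \<alpha> * monomial \<alpha> x" "\<lambda>x. \<Sum>\<alpha>\<in>I. c \<alpha> * monomial \<alpha> x"]
        hom_poly_cmult[OF hom_poly_monomial[of \<alpha> k]]
      by simp
  qed (simp_all add: assms(2) hom_poly_zero)
  then show ?thesis unfolding f by blast
qed

lemma hom_poly_mult:
  assumes "hom_poly k f" "hom_poly k' g"
  shows "hom_poly (k + k') (\<lambda>x. f x * g x)"
  using assms(1)
proof (induction rule: hom_poly_induct)
  case (monomial c \<alpha>)
  show ?case
    using assms(2)
  proof (induction rule: hom_poly_induct)
    case (monomial d \<beta>)
    have "monomial \<alpha> x * monomial \<beta> x = monomial (\<lambda>i. \<alpha> i + \<beta> i) x" for x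
      by (simp add: monomial_def power_add prod.distrib)
    then have "c * monomial \<alpha> x * (d * monomial \<beta> x) = c * d * monomial (\<lambda>i. \<alpha> i + \<beta> i) x" for x
      by (simp add: algebra_simps)
    moreover have "hom_poly (k + k') (monomial (\<lambda>i. \<alpha> i + \<beta> i))"
      using monomial \<open>int (sum \<alpha> UNIV) = k\<close>
      by (intro hom_poly_monomial) (simp add: sum.distrib)
    ultimately show ?case by (simp only: hom_poly_cmult)
  qed (simp_all add: hom_poly_zero hom_poly_add algebra_simps)
qed (simp_all add: hom_poly_zero hom_poly_add algebra_simps)

lemma hom_poly_const: "hom_poly 0 (\<lambda>x. c)"
  using hom_poly_cmult[OF hom_poly_monomial[of "\<lambda>_. 0" 0], of c] by (simp add: monomial_def)

lemma hom_poly_coord: "hom_poly 1 (\<lambda>x :: real ^ 'n::finite. x $ m)"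
proof -
  have "x $ m = monomial (\<lambda>i. if i = m then 1 else 0) x" for x :: "real ^ 'n"
  proof -
    have "monomial (\<lambda>i. if i = m then 1 else 0) x = (\<Prod>i\<in>UNIV. if i = m then x $ i else 1)"
      unfolding monomial_def by (rule prod.cong) auto
    then show ?thesis by (simp add: prod.delta)
  qed
  moreover have "hom_poly 1 (monomial (\<lambda>i. if i = m then 1 else 0))"
    by (rule hom_poly_monomial) simp
  ultimately show ?thesis by presburger
qed

lemma partial_deriv_unique: "(f has_derivative f') (at x) \<Longrightarrow> partial_deriv m f x = f' (axis m 1)"
  unfolding partial_deriv_def by (metis frechet_derivative_at)

lemma partial_deriv_const: "partial_deriv m (\<lambda>x. c) = (\<lambda>x. 0)"
  by (intro ext) (simp add: partial_deriv_unique[OF has_derivative_const])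

lemma partial_deriv_coord: "partial_deriv m (\<lambda>x. x $ j) x = (if j = m then 1 else 0)"
proof -
  have "((\<lambda>x. x $ j) has_derivative (\<lambda>h. h $ j)) (at x)"
    by (rule bounded_linear_imp_has_derivative[OF bounded_linear_vec_nth])
  from partial_deriv_unique[OF this] show ?thesis by (auto simp: axis_def)
qed

lemma partial_deriv_add:
  assumes "f differentiable (at x)" "g differentiable (at x)"
  shows "partial_deriv m (\<lambda>x. f x + g x) x = partial_deriv m f x + partial_deriv m g x"
  using partial_deriv_unique[OF has_derivative_add[OF
      assms(1)[unfolded frechet_derivative_works] assms(2)[unfolded frechet_derivative_works]]]
  by (simp add: partial_deriv_def)

lemma partial_deriv_mult:
  assumes "f differentiable (at x)" "g differentiable (at x)"
  shows "partial_deriv m (\<lambda>x. f x * g x) x = f x * partial_deriv m g x + partial_deriv m f x * g x"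
  using partial_deriv_unique[OF has_derivative_mult[OF
      assms(1)[unfolded frechet_derivative_works] assms(2)[unfolded frechet_derivative_works]]]
  by (simp add: partial_deriv_def)

lemma partial_deriv_cmult:
  assumes "f differentiable (at x)"
  shows "partial_deriv m (\<lambda>x. c * f x) x = c * partial_deriv m f x"
  using partial_deriv_mult[OF differentiable_const assms, of m c] by (simp add: partial_deriv_const)

lemma partial_deriv_sum:
  assumes "\<And>i. i \<in> I \<Longrightarrow> f i differentiable (at x)"
  shows "partial_deriv m (\<lambda>x. \<Sum>i\<in>I. f i x) x = (\<Sum>i\<in>I. partial_deriv m (f i) x)"
  using assms
proof (induction I rule: infinite_finite_induct)
  case (insert i I)
  then show ?case
    by (simp add: partial_deriv_add differentiable_sum)
qed (simp_all add: partial_deriv_const)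

lemma has_derivative_monomial:
  "(monomial \<alpha> has_derivative
     (\<lambda>h. \<Sum>i\<in>UNIV. real (\<alpha> i) * x $ i ^ (\<alpha> i - 1) * h $ i * (\<Prod>j\<in>UNIV - {i}. x $ j ^ \<alpha> j))) (at x)"
proof -
  have "((\<lambda>x. x $ i ^ \<alpha> i) has_derivative (\<lambda>h. real (\<alpha> i) * x $ i ^ (\<alpha> i - 1) * h $ i)) (at x)" for i
    by (rule has_derivative_eq_rhs, rule has_derivative_power, rule bounded_linear_imp_has_derivative,
        rule bounded_linear_vec_nth) (simp add: algebra_simps)
  from has_derivative_prod[of UNIV, OF this] show ?thesis
    unfolding monomial_def[abs_def] by simp
qed

lemma hom_poly_differentiable: "hom_poly k f \<Longrightarrow> f differentiable (at x)"
proof (induction rule: hom_poly_induct)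
  case (monomial c \<alpha>)
  show ?case using has_derivative_monomial[of \<alpha> x]
    by (intro differentiable_mult differentiable_const) (rule differentiableI)
qed simp_all

lemma differentiable_monomial: "monomial \<alpha> differentiable (at x)"
  by (rule hom_poly_differentiable[OF hom_poly_monomial[OF refl]])

text \<open>
  The exponent of the derivative of a monomial.  Truncation at \<open>\<alpha> m = 0\<close> is harmless since the
  derivative carries the factor \<open>\<alpha> m\<close>.
\<close>

definition lower :: "'n \<Rightarrow> ('n \<Rightarrow> nat) \<Rightarrow> 'n \<Rightarrow> nat" where
  "lower m \<alpha> = \<alpha>(m := \<alpha> m - 1)"

lemma monomial_split:
  "monomial \<alpha> x = x $ m ^ \<alpha> m * (\<Prod>j\<in>UNIV - {m}. x $ j ^ \<alpha> j)"
  unfolding monomial_def by (rule prod.remove) simp_all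

lemma partial_deriv_monomial:
  "partial_deriv m (monomial \<alpha>) x = real (\<alpha> m) * monomial (lower m \<alpha>) x"
proof -
  have "partial_deriv m (monomial \<alpha>) x = (\<Sum>i\<in>UNIV. if i = m then
      real (\<alpha> m) * x $ m ^ (\<alpha> m - 1) * (\<Prod>j\<in>UNIV - {m}. x $ j ^ \<alpha> j) else 0)"
    unfolding partial_deriv_unique[OF has_derivative_monomial]
    by (rule sum.cong) (auto simp: axis_def)
  also have "\<dots> = real (\<alpha> m) * (x $ m ^ (\<alpha> m - 1) * (\<Prod>j\<in>UNIV - {m}. x $ j ^ \<alpha> j))"
    by simp
  also have "x $ m ^ (\<alpha> m - 1) * (\<Prod>j\<in>UNIV - {m}. x $ j ^ \<alpha> j) = monomial (lower m \<alpha>) x"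
    by (subst monomial_split[of _ _ m]) (simp add: lower_def)
  finally show ?thesis .
qed

lemma hom_poly_partial_deriv:
  assumes "hom_poly k f" shows "hom_poly (k - 1) (partial_deriv m f)"
  using assms
proof (induction rule: hom_poly_induct)
  case zero
  show ?case by (simp add: partial_deriv_const hom_poly_zero)
next
  case (add f g)
  then have "partial_deriv m (\<lambda>x. f x + g x) = (\<lambda>x. partial_deriv m f x + partial_deriv m g x)"
    by (intro ext partial_deriv_add) (auto intro: hom_poly_differentiable)
  then show ?case using add by (simp add: hom_poly_add)
next
  case (monomial c \<alpha>)
  have eq: "partial_deriv m (\<lambda>x. c * monomial \<alpha> x) = (\<lambda>x. c * real (\<alpha> m) * monomial (lower m \<alpha>) x)"
    by (intro ext) (simp add: partial_deriv_cmult differentiable_monomial partial_deriv_monomial)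
  show ?case
  proof (cases "\<alpha> m = 0")
    case True
    then show ?thesis by (simp add: eq hom_poly_zero)
  next
    case False
    have "sum \<alpha> UNIV = \<alpha> m + sum \<alpha> (UNIV - {m})" by (rule sum.remove) simp_all
    moreover have "sum (lower m \<alpha>) UNIV = lower m \<alpha> m + sum (lower m \<alpha>) (UNIV - {m})"
      by (rule sum.remove) simp_all
    moreover have "sum (lower m \<alpha>) (UNIV - {m}) = sum \<alpha> (UNIV - {m})"
      by (rule sum.cong) (auto simp: lower_def)
    ultimately have "int (sum (lower m \<alpha>) UNIV) = k - 1"
      using monomial False by (simp add: lower_def)
    then show ?thesis unfolding eq by (intro hom_poly_cmult hom_poly_monomial)
  qed
qed

text \<open>
  On a monomial both mixed derivatives are the same multiple of a monomial with both exponents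
  lowered.
\<close>

lemma partial_deriv_commute:
  assumes "hom_poly k f"
  shows "partial_deriv m (partial_deriv j f) x = partial_deriv j (partial_deriv m f) x"
  using assms
proof (induction rule: hom_poly_induct)
  case zero
  show ?case by (simp add: partial_deriv_const)
next
  case (add f g)
  have eq: "partial_deriv m (\<lambda>x. f x + g x) = (\<lambda>x. partial_deriv m f x + partial_deriv m g x)" for m
    using add by (intro ext partial_deriv_add) (auto intro: hom_poly_differentiable)
  have d: "partial_deriv m f differentiable (at x)" "partial_deriv m g differentiable (at x)" for m
    using add by (auto intro: hom_poly_differentiable hom_poly_partial_deriv)
  show ?case using add by (simp add: eq partial_deriv_add d)
next
  case (monomial c \<alpha>)
  have eq: "partial_deriv m (\<lambda>x. c * monomial \<alpha> x) = (\<lambda>x. c * real (\<alpha> m) * monomial (lower m \<alpha>) x)" for m c \<alpha>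
    by (intro ext) (simp add: partial_deriv_cmult differentiable_monomial partial_deriv_monomial)
  show ?case
    by (cases "m = j") (simp_all add: eq lower_def fun_upd_twist)
qed

lemma euler_identity:
  assumes "hom_poly k f"
  shows "(\<Sum>m\<in>UNIV. x $ m * partial_deriv m f x) = real_of_int k * f x"
  using assms
proof (induction rule: hom_poly_induct)
  case zero
  show ?case by (simp add: partial_deriv_const)
next
  case (add f g)
  then show ?case
    by (simp add: partial_deriv_add hom_poly_differentiable[of k] algebra_simps sum.distrib)
next
  case (monomial c \<alpha>)
  have "x $ m * partial_deriv m (\<lambda>x. c * monomial \<alpha> x) x = real (\<alpha> m) * (c * monomial \<alpha> x)" for m
  proof (cases "\<alpha> m = 0")
    case False
    then have "x $ m * monomial (lower m \<alpha>) x = monomial \<alpha> x"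
      by (simp add: monomial_split[of _ _ m] lower_def flip: mult.assoc power_Suc)
    then show ?thesis
      by (simp add: partial_deriv_cmult differentiable_monomial partial_deriv_monomial mult_ac)
  qed (simp add: partial_deriv_cmult differentiable_monomial partial_deriv_monomial)
  moreover have "(\<Sum>m\<in>UNIV. real (\<alpha> m)) = real_of_int k"
    using monomial by (metis of_int_of_nat_eq of_nat_sum)
  ultimately show ?case by (simp flip: sum_distrib_right)
qed

section \<open>Poly-vector fields, trace and the bracket in coordinates\<close>

definition pd :: "'n::finite \<Rightarrow> 'n mvfield \<Rightarrow> 'n mvfield" where
  "pd m U = (\<lambda>js. partial_deriv m (U js))"

definition differentiable_field :: "'n::finite mvfield \<Rightarrow> bool" where
  "differentiable_field U \<longleftrightarrow> (\<forall>js x. U js differentiable (at x))"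

lemma polyvec_iff:
  "U \<in> polyvec k l \<longleftrightarrow> alternating U \<and> of_degree l U \<and> (\<forall>js. hom_poly k (U js))"
  by (simp add: polyvec_def of_degree_def)

lemma polyvec_of_degree: "U \<in> polyvec k l \<Longrightarrow> of_degree l U"
  and polyvec_alternating: "U \<in> polyvec k l \<Longrightarrow> alternating U"
  and polyvec_hom_poly: "U \<in> polyvec k l \<Longrightarrow> hom_poly k (U js)"
  by (simp_all add: polyvec_iff)

lemma polyvec_differentiable_field: "U \<in> polyvec k l \<Longrightarrow> differentiable_field U"
  unfolding differentiable_field_def by (blast intro: hom_poly_differentiable polyvec_hom_poly)

lemma alternatingI:
  "(\<And>J a b K. U (J @ [a, b] @ K) = - U (J @ [b, a] @ K)) \<Longrightarrow> alternating U"
  unfolding alternating_iff_adjacent by blast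

lemma polyvec_zero: "0 \<in> polyvec k l"
  by (simp add: polyvec_iff alternating_def of_degree_def zero_fun_def hom_poly_zero)

lemma polyvec_add:
  assumes "U \<in> polyvec k l" "W \<in> polyvec k l"
  shows "U + W \<in> polyvec k l"
proof -
  have "(U + W) js = (\<lambda>x. U js x + W js x)" for js by (simp add: plus_fun_def)
  then have "hom_poly k ((U + W) js)" for js
    using assms by (simp add: hom_poly_add polyvec_hom_poly)
  moreover have "alternating (U + W)"
    using assms by (simp add: polyvec_iff alternating_def)
  ultimately show ?thesis using assms by (simp add: polyvec_iff of_degree_def)
qed

lemma polyvec_scale:
  assumes "U \<in> polyvec k l" shows "c \<odot> U \<in> polyvec k l"
proof -
  have "hom_poly k ((c \<odot> U) js)" for js
    using assms by (simp add: mv_scale_def hom_poly_cmult polyvec_hom_poly)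
  moreover have "alternating (c \<odot> U)"
    using assms by (simp add: polyvec_iff alternating_def mv_scale_def fun_eq_iff)
  ultimately show ?thesis using assms by (simp add: polyvec_iff of_degree_def mv_scale_def fun_eq_iff)
qed

lemma polyvec_sum: "(\<And>i. i \<in> I \<Longrightarrow> F i \<in> polyvec k l) \<Longrightarrow> (\<Sum>i\<in>I. F i) \<in> polyvec k l"
  by (induction I rule: infinite_finite_induct) (simp_all add: polyvec_zero polyvec_add)

lemma polyvec_contract: "U \<in> polyvec k l \<Longrightarrow> contract m U \<in> polyvec k (l - 1)"
  unfolding polyvec_iff by (simp add: alternating_contract of_degree_contract) (simp add: contract_def)

lemma partial_deriv_zero: "partial_deriv m 0 = 0"
  unfolding zero_fun_def by (rule partial_deriv_const)

lemma partial_deriv_uminus: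
  "f differentiable (at x) \<Longrightarrow> partial_deriv m (- f) x = - partial_deriv m f x"
  using partial_deriv_cmult[of f x m "-1"] by (simp add: fun_Compl_def)

lemma polyvec_pd:
  assumes "U \<in> polyvec k l" shows "pd m U \<in> polyvec (k - 1) l"
proof -
  have "alternating (pd m U)"
  proof (rule alternatingI)
    fix J a b K
    have "U (J @ [b, a] @ K) differentiable (at x)" for x
      using polyvec_differentiable_field[OF assms] by (simp add: differentiable_field_def)
    then show "pd m U (J @ [a, b] @ K) = - pd m U (J @ [b, a] @ K)"
      unfolding pd_def alternating_adjacent[OF polyvec_alternating[OF assms], of J a b K]
      by (intro ext) (simp add: partial_deriv_uminus del: append_Cons append_Nil)
  qed
  then show ?thesis
    using assms by (simp add: polyvec_iff of_degree_def pd_def partial_deriv_zero hom_poly_partial_deriv)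
qed

lemma polyvec_wedge:
  assumes "U \<in> polyvec k u" "W \<in> polyvec k' w"
  shows "U \<and>\<^sub>w W \<in> polyvec (k + k') (u + w)"
proof -
  have "hom_poly (k + k') ((U \<and>\<^sub>w W) js)" for js
    unfolding wedge_def
    by (intro hom_poly_sum hom_poly_mult hom_poly_cmult polyvec_hom_poly[OF assms(1)]
        polyvec_hom_poly[OF assms(2)])
  then show ?thesis
    using assms by (simp add: polyvec_iff alternating_wedge of_degree_wedge)
qed

lemma trace_op_eq: "trace_op U = (\<Sum>m\<in>UNIV. pd m (contract m U))"
  by (intro ext) (simp add: trace_op_def sum_mvfield_apply pd_def contract_def)

lemma polyvec_trace: "U \<in> polyvec k l \<Longrightarrow> trace_op U \<in> polyvec (k - 1) (l - 1)"
  unfolding trace_op_eq by (intro polyvec_sum polyvec_pd polyvec_contract)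

lemma short_list_alternating:
  assumes "of_degree l U" "l \<le> 1"
  shows "alternating U"
proof (rule alternatingI)
  fix J K and a b :: 'a
  have "U js = 0" if "length js \<ge> 2" for js
    using assms that by (auto simp: of_degree_def)
  then show "U (J @ [a, b] @ K) = - U (J @ [b, a] @ K)" by simp
qed

lemma polyvec_coord: "coord_field m \<in> polyvec 0 1"
proof -
  have "of_degree 1 (coord_field m)" by (auto simp: of_degree_def coord_field_def fun_eq_iff)
  moreover have "hom_poly 0 (coord_field m js)" for js
    by (simp add: coord_field_def hom_poly_const)
  ultimately show ?thesis by (simp add: polyvec_iff short_list_alternating[where l = 1])
qed

lemma polyvec_euler: "(euler_field :: 'n::finite mvfield) \<in> polyvec 1 1"
proof -
  have "of_degree 1 (euler_field :: 'n mvfield)"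
    by (auto simp: of_degree_def euler_field_def fun_eq_iff split: list.split)
  moreover have "hom_poly 1 (euler_field js)" for js :: "'n list"
  proof (cases "\<exists>m. js = [m]")
    case True
    then show ?thesis by (auto simp: euler_field_def hom_poly_coord)
  next
    case False
    then have "euler_field js = (\<lambda>x. 0)" by (auto simp: euler_field_def split: list.split)
    then show ?thesis by (simp add: hom_poly_zero)
  qed
  ultimately show ?thesis by (simp add: polyvec_iff short_list_alternating[where l = 1])
qed

lemma pd_wedge:
  assumes "differentiable_field U" "differentiable_field W"
  shows "pd m (U \<and>\<^sub>w W) = U \<and>\<^sub>w pd m W + pd m U \<and>\<^sub>w W"
proof (intro ext)
  fix js x
  have d: "U J differentiable (at x)" "W J differentiable (at x)" for J
    using assms by (simp_all add: differentiable_field_def)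
  show "pd m (U \<and>\<^sub>w W) js x = (U \<and>\<^sub>w pd m W + pd m U \<and>\<^sub>w W) js x"
    by (simp add: pd_def wedge_def partial_deriv_sum partial_deriv_mult partial_deriv_const d
        sum.distrib algebra_simps)
qed

lemma differentiable_field_wedge:
  assumes "differentiable_field U" "differentiable_field W" shows "differentiable_field (U \<and>\<^sub>w W)"
  using assms unfolding differentiable_field_def wedge_def
  by (intro allI differentiable_sum ballI differentiable_mult differentiable_const) simp_all

lemma differentiable_field_contract: "differentiable_field U \<Longrightarrow> differentiable_field (contract m U)"
  by (simp add: differentiable_field_def contract_def)

lemma differentiable_field_twist: "differentiable_field U \<Longrightarrow> differentiable_field (twist U)"
  by (simp add: differentiable_field_def twist_def)

lemma pd_add: "differentiable_field U \<Longrightarrow> differentiable_field W \<Longrightarrow> pd m (U + W) = pd m U + pd m W"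
  by (intro ext) (simp add: pd_def differentiable_field_def partial_deriv_add plus_fun_def)

lemma pd_scale: "differentiable_field U \<Longrightarrow> pd m (c \<odot> U) = c \<odot> pd m U"
  by (intro ext) (simp add: pd_def differentiable_field_def partial_deriv_cmult mv_scale_def)

lemma of_degree_pd: "of_degree l U \<Longrightarrow> of_degree l (pd m U)"
  by (simp add: of_degree_def pd_def partial_deriv_zero)

lemma of_degree_twist: "of_degree l U \<Longrightarrow> of_degree l (twist U)"
  by (auto simp: of_degree_def twist_def fun_eq_iff)

text \<open>
  A symmetric pair of derivatives is contracted with an antisymmetric pair of indices.
\<close>

lemma trace_trace:
  assumes "U \<in> polyvec k l" shows "trace_op (trace_op U) = 0"
proof (intro ext)
  fix js x
  define F where "F m j = partial_deriv m (partial_deriv j (U (js @ [m, j]))) x" for m j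
  have hp: "hom_poly (k - 1) (partial_deriv j (U J))" for j J
    by (intro hom_poly_partial_deriv polyvec_hom_poly[OF assms])
  have dbl: "trace_op (trace_op U) js x = (\<Sum>m\<in>UNIV. \<Sum>j\<in>UNIV. F m j)"
    unfolding trace_op_def F_def
    by (subst partial_deriv_sum) (simp_all add: hom_poly_differentiable[OF hp])
  \<comment> \<open>Second derivatives are symmetric, the last two indices of \<open>U\<close> antisymmetric.\<close>
  have skew: "F m j = - F j m" for m j
  proof -
    have U: "U (js @ [m, j]) = - U (js @ [j, m])"
      using alternating_adjacent[OF polyvec_alternating[OF assms], of js m j "[]"] by simp
    have "partial_deriv j (U (js @ [m, j])) = - partial_deriv j (U (js @ [j, m]))"
      unfolding U by (intro ext)
        (simp add: partial_deriv_uminus hom_poly_differentiable[OF polyvec_hom_poly[OF assms]])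
    then have "F m j = - partial_deriv m (partial_deriv j (U (js @ [j, m]))) x"
      by (simp add: F_def partial_deriv_uminus hom_poly_differentiable[OF hp])
    then show ?thesis
      using partial_deriv_commute[OF polyvec_hom_poly[OF assms], of m j "js @ [j, m]" x]
      by (simp add: F_def)
  qed
  have "(\<Sum>m\<in>UNIV. \<Sum>j\<in>UNIV. F m j) = (\<Sum>m\<in>UNIV. \<Sum>j\<in>UNIV. - F j m)"
    by (intro sum.cong refl skew)
  then have "(\<Sum>m\<in>UNIV. \<Sum>j\<in>UNIV. F m j) = - (\<Sum>m\<in>UNIV. \<Sum>j\<in>UNIV. F j m)"
    by (simp only: sum_negf)
  moreover have "(\<Sum>m\<in>UNIV. \<Sum>j\<in>UNIV. F j m) = (\<Sum>m\<in>UNIV. \<Sum>j\<in>UNIV. F m j)"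
    by (rule sum.swap)
  ultimately show "trace_op (trace_op U) js x = 0 js x" using dbl by simp
qed

text \<open>
  The classical coordinate expression of the Schouten bracket, in a convention that contracts
  last indices; for \<open>W\<close> of degree \<open>w\<close> the second summand is \<open>(-1)\<^sup>w \<partial>\<^sub>m U \<and> \<iota>\<^sub>m W\<close>.
\<close>

definition coord_bracket :: "'n::finite mvfield \<Rightarrow> 'n mvfield \<Rightarrow> 'n mvfield" where
  "coord_bracket U W =
     (\<Sum>m\<in>UNIV. contract m U \<and>\<^sub>w pd m W + pd m U \<and>\<^sub>w contract m (twist W))"

text \<open>
  With \<open>D = \<Sum>\<^sub>m \<partial>\<^sub>m \<iota>\<^sub>m\<close>, the derivation \<open>\<partial>\<^sub>m\<close> and the graded derivation \<open>\<iota>\<^sub>m\<close> may act on the same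
  factor, which gives the first two terms, or on different factors, which gives the bracket.
\<close>

lemma trace_wedge:
  assumes "differentiable_field U" "differentiable_field W"
  shows "trace_op (U \<and>\<^sub>w W)
    = U \<and>\<^sub>w trace_op W + trace_op U \<and>\<^sub>w twist W + coord_bracket U (twist W)"
proof -
  have "pd m (contract m (U \<and>\<^sub>w W)) = U \<and>\<^sub>w pd m (contract m W) + pd m (contract m U) \<and>\<^sub>w twist W
     + (contract m U \<and>\<^sub>w pd m (twist W) + pd m U \<and>\<^sub>w contract m (twist (twist W)))" for m
    using assms by (simp add: contract_wedge pd_add pd_wedge differentiable_field_wedge differentiable_field_contract
        differentiable_field_twist twist_twist algebra_simps)
  then show ?thesis
    by (simp add: trace_op_eq coord_bracket_def wedge_sum_left wedge_sum_right sum.distrib)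
qed

text \<open>
  The Leibniz rule in the second argument is inherited from \<open>\<partial>\<^sub>m\<close> and \<open>\<iota>\<^sub>m\<close>.  The sign comes from
  moving \<open>W\<close> to the left: past \<open>\<iota>\<^sub>m U\<close> it is \<open>(-1)\<^bsup>(u-1)w\<^esup>\<close>, and past \<open>\<partial>\<^sub>m U\<close> the sign \<open>(-1)\<^bsup>u w\<^esup>\<close>
  combines with that of \<open>twist W\<close> to the same value.
\<close>

lemma coord_bracket_wedge:
  assumes "of_degree u U" "of_degree w W" "differentiable_field W" "differentiable_field Z"
  shows "coord_bracket U (W \<and>\<^sub>w Z)
    = coord_bracket U W \<and>\<^sub>w Z + ((-1) powi ((u - 1) * w)) \<odot> (W \<and>\<^sub>w coord_bracket U Z)"
proof -
  have c1: "contract m U \<and>\<^sub>w W = ((-1) powi ((u - 1) * w)) \<odot> (W \<and>\<^sub>w contract m U)" for m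
    using wedge_commute[OF assms(2) of_degree_contract[OF assms(1)], of m] by (simp add: mult.commute)
  have c2: "pd m U \<and>\<^sub>w twist W = ((-1) powi ((u - 1) * w)) \<odot> (W \<and>\<^sub>w pd m U)" for m
  proof -
    have "pd m U \<and>\<^sub>w W = ((-1) powi (w * u)) \<odot> (W \<and>\<^sub>w pd m U)"
      by (rule wedge_commute[OF assms(2) of_degree_pd[OF assms(1)]])
    then show ?thesis
      by (simp add: twist_of_degree[OF assms(2)] wedge_scale_right mv_scale_simps minus_one_powi_eq_if)
  qed
  have "contract m U \<and>\<^sub>w pd m (W \<and>\<^sub>w Z) + pd m U \<and>\<^sub>w contract m (twist (W \<and>\<^sub>w Z))
     = (contract m U \<and>\<^sub>w pd m W + pd m U \<and>\<^sub>w contract m (twist W)) \<and>\<^sub>w Z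
       + ((-1) powi ((u - 1) * w)) \<odot> (W \<and>\<^sub>w (contract m U \<and>\<^sub>w pd m Z + pd m U \<and>\<^sub>w contract m (twist Z)))" for m
  proof -
    have "contract m U \<and>\<^sub>w pd m (W \<and>\<^sub>w Z) + pd m U \<and>\<^sub>w contract m (twist (W \<and>\<^sub>w Z))
      = (contract m U \<and>\<^sub>w W) \<and>\<^sub>w pd m Z + contract m U \<and>\<^sub>w pd m W \<and>\<^sub>w Z
        + (pd m U \<and>\<^sub>w twist W) \<and>\<^sub>w contract m (twist Z) + pd m U \<and>\<^sub>w contract m (twist W) \<and>\<^sub>w Z"
      using assms by (simp add: pd_wedge twist_wedge contract_wedge twist_twist wedge_add_right wedge_assoc)
    also have "\<dots> = (contract m U \<and>\<^sub>w pd m W + pd m U \<and>\<^sub>w contract m (twist W)) \<and>\<^sub>w Z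
       + (((-1) powi ((u - 1) * w)) \<odot> (W \<and>\<^sub>w contract m U)) \<and>\<^sub>w pd m Z
       + (((-1) powi ((u - 1) * w)) \<odot> (W \<and>\<^sub>w pd m U)) \<and>\<^sub>w contract m (twist Z)"
      unfolding c1 c2 by (simp add: wedge_add_left add_ac)
    finally show ?thesis
      by (simp add: wedge_scale_left wedge_assoc wedge_add_right mv_scale_add add.assoc)
  qed
  then show ?thesis
    unfolding coord_bracket_def wedge_sum_left wedge_sum_right mv_scale_sum sum.distrib[symmetric]
    by (intro sum.cong refl)
qed

lemma coord_bracket_scale: "differentiable_field W \<Longrightarrow> coord_bracket U (c \<odot> W) = c \<odot> coord_bracket U W"
proof -
  have "twist (c \<odot> W) = c \<odot> twist W" by (simp add: twist_def mv_scale_def fun_eq_iff)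
  then show "differentiable_field W \<Longrightarrow> coord_bracket U (c \<odot> W) = c \<odot> coord_bracket U W"
    by (simp add: coord_bracket_def mv_scale_sum pd_scale contract_scale wedge_scale_right)
      (simp add: mv_scale_def fun_eq_iff sum_mvfield_apply algebra_simps)
qed

lemma coord_bracket_add:
  "differentiable_field W \<Longrightarrow> differentiable_field W' \<Longrightarrow> coord_bracket U (W + W') = coord_bracket U W + coord_bracket U W'"
  by (simp add: coord_bracket_def twist_add pd_add contract_add wedge_add_right sum.distrib)

lemma coord_bracket_zero: "coord_bracket U 0 = 0"
  using coord_bracket_scale[of 0 U 0] by (simp add: mv_scale_simps differentiable_field_def zero_fun_def)

lemma coord_bracket_sum:
  "(\<And>i. i \<in> I \<Longrightarrow> F i \<in> polyvec k w) \<Longrightarrow>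
    coord_bracket U (\<Sum>i\<in>I. F i) = (\<Sum>i\<in>I. coord_bracket U (F i))"
proof (induction I rule: infinite_finite_induct)
  case (insert i I)
  have "differentiable_field (F i)" "differentiable_field (sum F I)"
    using insert by (auto intro: polyvec_differentiable_field polyvec_sum)
  then show ?case
    using insert.IH insert.prems
    by (simp only: sum.insert[OF insert.hyps] coord_bracket_add insertI2)
qed (simp_all add: coord_bracket_zero)

text \<open>
  Contractions of a function vanish, so one summand survives on each side; these two differ by the
  order of the factors and by the sign of \<open>twist U\<close>.
\<close>

lemma coord_bracket_function_left:
  assumes "g \<in> polyvec k 0" "of_degree u U"
  shows "coord_bracket g U = ((-1) powi u) \<odot> coord_bracket U g"
proof -
  have z: "contract m g = 0" "contract m (twist g) = 0" for m
    using polyvec_of_degree[OF assms(1)] of_degree_twist[OF polyvec_of_degree[OF assms(1)]]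
    by (simp_all add: contract_def of_degree_def fun_eq_iff)
  have "pd m g \<and>\<^sub>w contract m (twist U) = ((-1) powi u) \<odot> (contract m U \<and>\<^sub>w pd m g)" for m
    using wedge_commute[OF of_degree_contract[OF assms(2)] of_degree_pd[OF polyvec_of_degree[OF assms(1)]], of m m]
    by (simp add: twist_of_degree[OF assms(2)] contract_scale wedge_scale_right mv_scale_simps)
  then show ?thesis
    by (simp add: coord_bracket_def z wedge_zero_left wedge_zero_right mv_scale_sum)
qed

lemma coord_bracket_coord: "coord_bracket U (coord_field m) = - pd m U"
proof -
  have "pd j (coord_field m) = 0" for j
    by (simp add: pd_def coord_field_def fun_eq_iff partial_deriv_const)
  moreover have "contract j (twist (coord_field m)) = (if j = m then - unit_field else 0)" for j
    by (simp add: contract_twist contract_coord) (auto simp: twist_def unit_field_def fun_eq_iff)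
  ultimately have "coord_bracket U (coord_field m)
      = (\<Sum>j\<in>UNIV. if j = m then - pd m U else 0)"
    unfolding coord_bracket_def
    by (intro sum.cong refl) (simp add: wedge_zero_right wedge_minus_right wedge_unit)
  then show ?thesis by simp
qed

lemma lie_deriv_coord: "lie_deriv (coord_field m) U = pd m U"
proof (intro ext)
  fix js x
  have "partial_deriv j (coord_field m J) = (\<lambda>x. 0)" for j J
    by (simp add: coord_field_def partial_deriv_const)
  moreover have "(\<Sum>j\<in>UNIV. coord_field m [j] x * partial_deriv j (U js) x)
      = (\<Sum>j\<in>UNIV. if j = m then partial_deriv m (U js) x else 0)"
    by (intro sum.cong refl) (auto simp: coord_field_def)
  ultimately show "lie_deriv (coord_field m) U js x = pd m U js x"
    by (simp add: lie_deriv_def pd_def)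
qed

text \<open>
  Euler's identity gives \<open>k\<close>, and each of the \<open>l\<close> indices contributes \<open>-1\<close>.
\<close>

lemma lie_deriv_euler:
  assumes "U \<in> polyvec k l"
  shows "lie_deriv euler_field U = real_of_int (k - l) \<odot> U"
proof (intro ext)
  fix js x
  have e: "euler_field [i] = (\<lambda>x. x $ i)" for i :: 'a by (simp add: euler_field_def)
  have "(\<Sum>m\<in>UNIV. U (js[r := m]) x * partial_deriv m (euler_field [js ! r]) x) = U js x"
    for r
  proof -
    have "(\<Sum>m\<in>UNIV. U (js[r := m]) x * partial_deriv m (euler_field [js ! r]) x)
        = (\<Sum>m\<in>UNIV. if m = js ! r then U js x else 0)"
      by (intro sum.cong refl) (auto simp: e partial_deriv_coord)
    then show ?thesis by simp
  qed
  then have "lie_deriv euler_field U js x = real_of_int k * U js x - real (length js) * U js x"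
    using euler_identity[OF polyvec_hom_poly[OF assms], of x js]
    by (simp add: lie_deriv_def e)
  also have "real (length js) * U js x = real_of_int l * U js x"
    using polyvec_of_degree[OF assms] unfolding of_degree_def
    by (metis mult_zero_right of_int_of_nat_eq zero_fun_apply)
  finally show "lie_deriv euler_field U js x = (real_of_int (k - l) \<odot> U) js x"
    by (simp add: mv_scale_def algebra_simps)
qed

lemma sum_contract_wedge_coord:
  assumes "W \<in> polyvec k w"
  shows "(\<Sum>m\<in>UNIV. contract m W \<and>\<^sub>w coord_field m) = real_of_int w \<odot> W"
proof (intro ext)
  fix js x
  show "(\<Sum>m\<in>UNIV. contract m W \<and>\<^sub>w coord_field m) js x = (real_of_int w \<odot> W) js x"
    using polyvec_of_degree[OF assms]
    unfolding sum_mvfield_apply sum_contract_wedge_coord_apply[OF polyvec_alternating[OF assms]]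
      mv_scale_apply of_degree_def
    by (metis mult_zero_right of_int_of_nat_eq zero_fun_apply)
qed

lemma trace_op_add: "differentiable_field U \<Longrightarrow> differentiable_field W \<Longrightarrow> trace_op (U + W) = trace_op U + trace_op W"
  by (simp add: trace_op_eq contract_add pd_add differentiable_field_contract sum.distrib)

lemma trace_op_scale: "differentiable_field U \<Longrightarrow> trace_op (c \<odot> U) = c \<odot> trace_op U"
  by (simp add: trace_op_eq contract_scale pd_scale differentiable_field_contract mv_scale_sum)

section \<open>The Schouten bracket is generated by the trace\<close>

context
  fixes br :: "'n::finite mvfield \<Rightarrow> 'n mvfield \<Rightarrow> 'n mvfield"
  assumes br: "schouten_bracket br"
begin

lemma br_closed:
  "U \<in> polyvec k u \<Longrightarrow> W \<in> polyvec k' w \<Longrightarrow> br U W \<in> polyvec (k + k' - 1) (u + w - 1)"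
  by (rule br[unfolded schouten_bracket_def, THEN conjunct1, rule_format])

lemma br_combination_left:
  "U \<in> polyvec k u \<Longrightarrow> U' \<in> polyvec k u \<Longrightarrow> W \<in> polyvec k' w \<Longrightarrow>
    br (a \<odot> U + b \<odot> U') W = a \<odot> br U W + b \<odot> br U' W"
  by (rule br[unfolded schouten_bracket_def, THEN conjunct2, THEN conjunct1, rule_format])

lemma br_combination_right:
  "U \<in> polyvec k u \<Longrightarrow> W \<in> polyvec k' w \<Longrightarrow> W' \<in> polyvec k' w \<Longrightarrow>
    br U (a \<odot> W + b \<odot> W') = a \<odot> br U W + b \<odot> br U W'"
  by (rule br[unfolded schouten_bracket_def, THEN conjunct2, THEN conjunct2, THEN conjunct1, rule_format])

lemma br_vector_field: "X \<in> polyvec k 1 \<Longrightarrow> U \<in> polyvec k' u \<Longrightarrow> br X U = lie_deriv X U"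
  by (rule br[unfolded schouten_bracket_def, THEN conjunct2, THEN conjunct2, THEN conjunct2, THEN conjunct1, rule_format])

lemma br_functions: "f \<in> polyvec k 0 \<Longrightarrow> g \<in> polyvec k' 0 \<Longrightarrow> br f g = 0"
  by (rule br[unfolded schouten_bracket_def, THEN conjunct2, THEN conjunct2, THEN conjunct2, THEN conjunct2, THEN conjunct1, rule_format])

lemma br_swap:
  "U \<in> polyvec k u \<Longrightarrow> W \<in> polyvec k' w \<Longrightarrow>
    br U W = (- ((-1) powi ((u - 1) * (w - 1)))) \<odot> br W U"
  by (rule br[unfolded schouten_bracket_def, THEN conjunct2, THEN conjunct2, THEN conjunct2, THEN conjunct2, THEN conjunct2, THEN conjunct1, rule_format])

lemma br_wedge:
  "U \<in> polyvec k u \<Longrightarrow> W \<in> polyvec k' w \<Longrightarrow> Z \<in> polyvec k'' z \<Longrightarrow>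
    br U (W \<and>\<^sub>w Z) = br U W \<and>\<^sub>w Z + ((-1) powi ((u - 1) * w)) \<odot> (W \<and>\<^sub>w br U Z)"
  by (rule br[unfolded schouten_bracket_def, THEN conjunct2, THEN conjunct2, THEN conjunct2, THEN conjunct2, THEN conjunct2, THEN conjunct2, rule_format])

lemma br_scale_right:
  assumes "U \<in> polyvec k u" "W \<in> polyvec k' w" shows "br U (c \<odot> W) = c \<odot> br U W"
  using br_combination_right[OF assms assms(2), of c 0] by (simp add: mv_scale_simps)

lemma br_add_right:
  assumes "U \<in> polyvec k u" "W \<in> polyvec k' w" "W' \<in> polyvec k' w"
  shows "br U (W + W') = br U W + br U W'"
  using br_combination_right[OF assms, of 1 1] by (simp only: mv_scale_simps)

lemma br_zero_right: "U \<in> polyvec k u \<Longrightarrow> br U 0 = 0"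
  using br_scale_right[OF _ polyvec_zero, of U k u 0] by (simp add: mv_scale_simps)

lemma br_sum_right:
  assumes "U \<in> polyvec k u" "\<And>i. i \<in> I \<Longrightarrow> F i \<in> polyvec k' w"
  shows "br U (\<Sum>i\<in>I. F i) = (\<Sum>i\<in>I. br U (F i))"
  using assms(2)
proof (induction I rule: infinite_finite_induct)
  case (insert i I)
  have "F i \<in> polyvec k' w" "sum F I \<in> polyvec k' w"
    using insert.prems by (auto intro: polyvec_sum)
  then show ?case
    using insert.IH insert.prems
    by (simp only: sum.insert[OF insert.hyps] br_add_right[OF assms(1)] insertI2)
qed (simp_all add: br_zero_right[OF assms(1)])

lemma br_coord_right:
  assumes "U \<in> polyvec k u" shows "br U (coord_field m) = coord_bracket U (coord_field m)"
  using br_swap[OF assms polyvec_coord, of m] br_vector_field[OF polyvec_coord assms, of m]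
  by (simp add: lie_deriv_coord coord_bracket_coord mv_scale_simps)

text \<open>
  Induction on the degree of \<open>W\<close>: both brackets satisfy the same Leibniz rule, and
  \<open>W = 1/w \<Sum>\<^sub>m (\<iota>\<^sub>m W) \<and> \<partial>\<^sub>m\<close> reduces degree \<open>w\<close> to degree \<open>w - 1\<close> and coordinate fields.
\<close>

lemma br_eq_coord_bracket_if_functions:
  assumes U: "U \<in> polyvec k u"
    and fns: "\<And>k' g. g \<in> polyvec k' 0 \<Longrightarrow> br U g = coord_bracket U g"
    and W: "W \<in> polyvec k' w"
  shows "br U W = coord_bracket U W"
proof (cases "w < 0")
  case True
  then have "W = 0" using polyvec_of_degree[OF W] by (auto simp: of_degree_def fun_eq_iff)
  then show ?thesis using br_zero_right[OF U] by (simp only: coord_bracket_zero)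
next
  case False
  have "br U W = coord_bracket U W" if "W \<in> polyvec k' (int p)" for p W k'
    using that
  proof (induction p arbitrary: W)
    case 0
    then show ?case using fns by simp
  next
    case (Suc p)
    let ?F = "\<lambda>m. contract m W \<and>\<^sub>w coord_field m"
    have c: "contract m W \<in> polyvec k' (int p)" for m
      using polyvec_contract[OF Suc.prems, of m] by simp
    have F: "?F m \<in> polyvec (k' + 0) (int p + 1)" for m
      by (intro polyvec_wedge c polyvec_coord)
    have "br U (?F m) = coord_bracket U (?F m)" for m
      unfolding br_wedge[OF U c polyvec_coord] br_coord_right[OF U] Suc.IH[OF c]
      by (rule coord_bracket_wedge[symmetric, OF polyvec_of_degree[OF U] polyvec_of_degree[OF c]
           polyvec_differentiable_field[OF c] polyvec_differentiable_field[OF polyvec_coord]])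
    moreover have "br U (\<Sum>m\<in>UNIV. ?F m) = (\<Sum>m\<in>UNIV. br U (?F m))"
      by (rule br_sum_right[OF U F])
    moreover have "coord_bracket U (\<Sum>m\<in>UNIV. ?F m) = (\<Sum>m\<in>UNIV. coord_bracket U (?F m))"
      by (rule coord_bracket_sum[OF F])
    ultimately have s: "br U (\<Sum>m\<in>UNIV. ?F m) = coord_bracket U (\<Sum>m\<in>UNIV. ?F m)"
      by (simp only:)
    have W: "W = (1 / real (Suc p)) \<odot> (\<Sum>m\<in>UNIV. ?F m)"
      unfolding sum_contract_wedge_coord[OF Suc.prems] by (simp add: mv_scale_simps)
    have P: "(\<Sum>m\<in>UNIV. ?F m) \<in> polyvec (k' + 0) (int p + 1)" by (intro polyvec_sum F)
    show ?case
      by (subst (1 2) W) (simp only: br_scale_right[OF U P] coord_bracket_scale[OF polyvec_differentiable_field[OF P]] s)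
  qed
  from this[of W k' "nat w"] False W show ?thesis by simp
qed

text \<open>
  The reduction to functions is used twice.  For a function \<open>g\<close> in the first argument, brackets with
  functions vanish on both sides, so the two agree on all \<open>U\<close>; by graded symmetry they agree on
  \<open>(U, g)\<close> as well, and this is the hypothesis of the reduction for \<open>U\<close>.
\<close>

lemma br_eq_coord_bracket:
  assumes "U \<in> polyvec k u" "W \<in> polyvec k' w"
  shows "br U W = coord_bracket U W"
proof (rule br_eq_coord_bracket_if_functions[OF assms(1) _ assms(2)])
  fix k'' and g :: "'n mvfield" assume g: "g \<in> polyvec k'' 0"
  have "coord_bracket g h = 0" if "h \<in> polyvec j 0" for h and j :: int
  proof -
    have "contract m f = 0" if "of_degree 0 f" for m and f :: "'n mvfield"
      using that by (simp add: contract_def of_degree_def fun_eq_iff)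
    then show ?thesis
      using polyvec_of_degree[OF g] of_degree_twist[OF polyvec_of_degree[OF that]]
      by (simp add: coord_bracket_def wedge_zero_left wedge_zero_right)
  qed
  then have "br g U = coord_bracket g U"
    by (intro br_eq_coord_bracket_if_functions[OF g _ assms(1)]) (simp add: br_functions[OF g])
  then show "br U g = coord_bracket U g"
    using br_swap[OF assms(1) g] coord_bracket_function_left[OF g polyvec_of_degree[OF assms(1)]]
    by (cases "even u") (simp_all add: minus_one_powi_eq_if mv_scale_simps)
qed

text \<open>
  Apply \<open>D\<close> to \<open>D (A \<and> A) = 2 (D A) \<and> A + [A, A]\<close>: the left side vanishes, and
  \<open>D ((D A) \<and> A) = [D A, A]\<close> since \<open>D A \<and> D A = 0\<close> and \<open>D (D A) = 0\<close>.
\<close>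

lemma trace_br_self:
  assumes A: "A \<in> polyvec k l" and "even l"
  shows "trace_op (br A A) = (- 2) \<odot> br (trace_op A) A"
proof -
  let ?B = "trace_op A"
  have B: "?B \<in> polyvec (k - 1) (l - 1)" by (rule polyvec_trace[OF A])
  have tA: "twist A = A"
    using twist_of_degree[OF polyvec_of_degree[OF A]] \<open>even l\<close>
    by (simp add: minus_one_powi_eq_if mv_scale_simps)
  have BA: "A \<and>\<^sub>w ?B = ?B \<and>\<^sub>w A"
    using wedge_commute[OF polyvec_of_degree[OF B] polyvec_of_degree[OF A]] \<open>even l\<close>
    by (simp add: minus_one_powi_eq_if mv_scale_simps)
  have BB: "?B \<and>\<^sub>w ?B = 0"
    using wedge_self_odd[OF polyvec_of_degree[OF B]] \<open>even l\<close> by simp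
  note sA = polyvec_differentiable_field[OF A] and sB = polyvec_differentiable_field[OF B]
  have "trace_op (A \<and>\<^sub>w A) = 2 \<odot> (?B \<and>\<^sub>w A) + br A A"
    using trace_wedge[OF sA sA] br_eq_coord_bracket[OF A A]
    by (simp add: tA BA mv_scale_def fun_eq_iff)
  moreover have "trace_op (?B \<and>\<^sub>w A) = br ?B A"
    using trace_wedge[OF sB sA] br_eq_coord_bracket[OF B A] trace_trace[OF A]
    by (simp add: tA BB wedge_zero_left)
  moreover have "trace_op (trace_op (A \<and>\<^sub>w A)) = 0"
    by (rule trace_trace[OF polyvec_wedge[OF A A]])
  moreover have "trace_op (2 \<odot> (?B \<and>\<^sub>w A) + br A A) = 2 \<odot> trace_op (?B \<and>\<^sub>w A) + trace_op (br A A)"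
    using sA sB by (simp add: trace_op_add trace_op_scale differentiable_field_wedge
        polyvec_differentiable_field[OF polyvec_scale[OF polyvec_wedge[OF B A]]] polyvec_differentiable_field[OF br_closed[OF A A]])
  ultimately have "2 \<odot> br ?B A + trace_op (br A A) = 0" by simp
  then show ?thesis
    by (simp add: fun_eq_iff mv_scale_def) (metis add.commute eq_neg_iff_add_eq_0)
qed

section \<open>Brackets with the Euler field\<close>

lemma br_euler_right:
  assumes "U \<in> polyvec k u" shows "br U euler_field = (- real_of_int (k - u)) \<odot> U"
  using br_swap[OF assms polyvec_euler] br_vector_field[OF polyvec_euler assms]
  by (simp add: lie_deriv_euler[OF assms] mv_scale_simps)

lemma br_self_odd:
  assumes "U \<in> polyvec k u" "odd u" shows "br U U = 0"
proof -
  have "br U U = - br U U"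
    using br_swap[OF assms(1) assms(1)] assms(2)
    by (simp only: minus_one_powi_eq_if even_mult_iff even_diff odd_one) (simp add: mv_scale_simps)
  then show ?thesis by (simp add: fun_eq_iff)
qed

lemma br_add_scaled_self_even:
  assumes U: "U \<in> polyvec k u" and W: "W \<in> polyvec k u" and "even u"
  shows "br (U + c \<odot> W) (U + c \<odot> W) = br U U + (2 * c) \<odot> br U W + c\<^sup>2 \<odot> br W W"
proof -
  have UW: "U + c \<odot> W = 1 \<odot> U + c \<odot> W" by (simp add: mv_scale_simps)
  have "br W U = br U W"
    using br_swap[OF W U] \<open>even u\<close> by (simp add: minus_one_powi_eq_if mv_scale_simps)
  moreover have "1 \<odot> U + c \<odot> W \<in> polyvec k u" by (intro polyvec_add polyvec_scale U W)
  ultimately show ?thesis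
    unfolding UW by (simp add: br_combination_left[OF U W] br_combination_right[OF U U W]
        br_combination_right[OF W U W])
      (simp add: mv_scale_def fun_eq_iff algebra_simps power2_eq_square)
qed

text \<open>
  The Leibniz rule leaves \<open>[B, B] \<and> e\<^sub>0\<close> and a multiple of \<open>B \<and> B\<close>.
\<close>

lemma br_odd_wedge_euler:
  assumes B: "B \<in> polyvec k b" and "odd b"
  shows "br B (B \<and>\<^sub>w euler_field) = 0"
  using \<open>odd b\<close> wedge_self_odd[OF polyvec_of_degree[OF B] \<open>odd b\<close>]
  by (simp add: br_wedge[OF B B polyvec_euler] br_self_odd[OF B] br_euler_right[OF B]
      wedge_zero_left wedge_scale_right mv_scale_simps)

text \<open>
  Applied to the second factor, the Leibniz rule leaves \<open>[B \<and> e\<^sub>0, B] \<and> e\<^sub>0\<close> and a multiple of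
  \<open>B \<and> B \<and> e\<^sub>0\<close>.
\<close>

lemma br_wedge_euler_self:
  assumes B: "B \<in> polyvec k b" and "odd b"
  shows "br (B \<and>\<^sub>w euler_field) (B \<and>\<^sub>w euler_field) = 0"
proof -
  have P: "B \<and>\<^sub>w euler_field \<in> polyvec (k + 1) (b + 1)" by (intro polyvec_wedge B polyvec_euler)
  have "br (B \<and>\<^sub>w euler_field) B = 0"
    using br_swap[OF P B] br_odd_wedge_euler[OF assms] by (simp add: mv_scale_simps)
  moreover have "B \<and>\<^sub>w (B \<and>\<^sub>w euler_field) = 0"
    using wedge_self_odd[OF polyvec_of_degree[OF B] \<open>odd b\<close>]
    by (simp add: wedge_assoc[symmetric] wedge_zero_left)
  ultimately show ?thesis
    by (simp add: br_wedge[OF P B polyvec_euler] br_euler_right[OF P]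
      wedge_zero_left wedge_scale_right mv_scale_simps)
qed

text \<open>
  The only mixed term that survives in \<open>[A, A]\<close>; the Euler field supplies the factor \<open>k - u\<close>.
\<close>

lemma br_even_wedge_euler:
  assumes U: "U \<in> polyvec k u" and "even u" and B: "B \<in> polyvec k' b" and "odd b"
  shows "br U (B \<and>\<^sub>w euler_field)
    = real_of_int (k - u) \<odot> (B \<and>\<^sub>w U) + (- 1) \<odot> (br B U \<and>\<^sub>w euler_field)"
proof -
  have "br U B = (- 1) \<odot> br B U"
    using br_swap[OF U B] \<open>even u\<close> \<open>odd b\<close> by (simp add: minus_one_powi_eq_if)
  then show ?thesis
    using \<open>even u\<close> \<open>odd b\<close>
    by (simp add: br_wedge[OF U B polyvec_euler] br_euler_right[OF U] wedge_scale_left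
        wedge_scale_right minus_one_powi_eq_if)
      (simp add: mv_scale_def fun_eq_iff algebra_simps)
qed

end

section \<open>Trace-free part of the bracket\<close>

theorem corollary3p6:
  fixes br :: "'n::finite mvfield \<Rightarrow> 'n mvfield \<Rightarrow> 'n mvfield"
    and A A\<^sub>0 :: "'n mvfield" and k l :: int
  assumes "schouten_bracket br"
    and "A \<in> polyvec k l"
    and "even l"
    and "int CARD('n) + k - l \<noteq> 0"
    and "int CARD('n) + 2 * k - 2 * l \<noteq> 0"
    and "A = A\<^sub>0 + trace_op A \<and>\<^sub>w e_field k l"
    and "trace_op A\<^sub>0 = 0"
  shows "br A A - trace_op (br A A) \<and>\<^sub>w e_field (2 * k) (2 * l)
           = br A\<^sub>0 A\<^sub>0
             + (2 * real_of_int (k - l) / real_of_int (int CARD('n) + k - l)) \<odot>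
               (trace_op A \<and>\<^sub>w A\<^sub>0 - br (trace_op A) A\<^sub>0 \<and>\<^sub>w e_field (2 * k) (2 * l))
         \<and> trace_op (br A A) = (- 2) \<odot> br (trace_op A) A\<^sub>0
         \<and> br (trace_op A) A\<^sub>0 = br (trace_op A) A
         \<and> trace_op A \<and>\<^sub>w A\<^sub>0 = trace_op A \<and>\<^sub>w A"
proof -
  note br = assms(1) and A = assms(2)
  define B where "B = trace_op A"
  define P where "P = B \<and>\<^sub>w euler_field"
  define N where "N = real_of_int (int CARD('n) + k - l)"
  define d where "d = real_of_int (k - l)"
  have N: "N \<noteq> 0" using assms(4) unfolding N_def by (simp only: of_int_eq_0_iff not_False_eq_True)
  have "N + d = real_of_int (int CARD('n) + 2 * k - 2 * l)" by (simp add: N_def d_def)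
  then have Nd: "N + d \<noteq> 0" and e2: "e_field (2 * k) (2 * l) = (1 / (N + d)) \<odot> (euler_field :: 'n mvfield)"
    using assms(5) by (simp_all only: of_int_eq_0_iff e_field_def not_False_eq_True)
  have B: "B \<in> polyvec (k - 1) (l - 1)" unfolding B_def by (rule polyvec_trace[OF A])
  have P: "P \<in> polyvec k l"
    using polyvec_wedge[OF B polyvec_euler] by (simp add: P_def)
  have odd: "odd (l - 1)" using assms(3) by simp
  have BB: "B \<and>\<^sub>w B = 0" by (rule wedge_self_odd[OF polyvec_of_degree[OF B] odd])
  have A_eq: "A = A\<^sub>0 + (1 / N) \<odot> P"
    using assms(6) by (simp add: B_def P_def N_def e_field_def wedge_scale_right)
  have A0: "A\<^sub>0 \<in> polyvec k l"
  proof -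
    have "A\<^sub>0 = A + (- 1 / N) \<odot> P" by (subst A_eq) (simp add: fun_eq_iff mv_scale_def)
    then show ?thesis using polyvec_add[OF A polyvec_scale[OF P]] by simp
  qed
  have wedge_eq: "B \<and>\<^sub>w A = B \<and>\<^sub>w A\<^sub>0"
    by (simp add: A_eq P_def wedge_add_right wedge_scale_right wedge_assoc[symmetric] BB
        wedge_zero_left mv_scale_simps)
  have br_eq: "br B A = br B A\<^sub>0"
    using br_add_right[OF br B A0 polyvec_scale[OF P]] br_scale_right[OF br B P]
      br_odd_wedge_euler[OF br B odd]
    by (simp add: A_eq P_def mv_scale_simps)
  have trace_eq: "trace_op (br A A) = (- 2) \<odot> br B A\<^sub>0"
    using trace_br_self[OF br A assms(3)] by (simp add: br_eq flip: B_def)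
  have "br A A = br A\<^sub>0 A\<^sub>0 + (2 / N) \<odot> br A\<^sub>0 P"
    using br_add_scaled_self_even[OF br A0 P assms(3), of "1 / N", folded A_eq]
      br_wedge_euler_self[OF br B odd, folded P_def]
    by (simp add: mv_scale_simps)
  also have "br A\<^sub>0 P = d \<odot> (B \<and>\<^sub>w A\<^sub>0) + (- 1) \<odot> (br B A\<^sub>0 \<and>\<^sub>w euler_field)"
    unfolding P_def d_def by (rule br_even_wedge_euler[OF br A0 assms(3) B odd])
  finally have brAA: "br A A = br A\<^sub>0 A\<^sub>0
      + (2 / N) \<odot> (d \<odot> (B \<and>\<^sub>w A\<^sub>0) + (- 1) \<odot> (br B A\<^sub>0 \<and>\<^sub>w euler_field))" .
  \<comment> \<open>\<open>2 / (N + d)\<close> comes from the subtracted trace part and \<open>- 2 / N\<close> from \<open>[A, A]\<close> itself.\<close>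
  have coeff: "2 / (N + d) - 2 / N = - (2 * d / N) * (1 / (N + d))"
    using N Nd by (simp add: field_simps)
  have "br A A - trace_op (br A A) \<and>\<^sub>w e_field (2 * k) (2 * l)
      = br A\<^sub>0 A\<^sub>0 + (2 * d / N) \<odot> (B \<and>\<^sub>w A\<^sub>0)
        + (2 / (N + d) - 2 / N) \<odot> (br B A\<^sub>0 \<and>\<^sub>w euler_field)"
    unfolding trace_eq e2 wedge_scale_left wedge_scale_right unfolding brAA
    by (simp add: mv_scale_apply fun_eq_iff algebra_simps)
  also have "\<dots> = br A\<^sub>0 A\<^sub>0
      + (2 * d / N) \<odot> (B \<and>\<^sub>w A\<^sub>0 - br B A\<^sub>0 \<and>\<^sub>w e_field (2 * k) (2 * l))"
    unfolding coeff e2 wedge_scale_right by (simp add: mv_scale_apply fun_eq_iff algebra_simps)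
  finally show ?thesis
    using trace_eq br_eq wedge_eq by (simp only: B_def N_def d_def)
qed

end
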